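(* Let $n$ be a positive integer. There exists a flexible Latin directed triple system of order $n$ (a flexible LDTS($n$)) if and only if $n \equiv 0$ or $1 \pmod 3$ and $n \notin \{4, 6, 10, 12\}$.
   Context: A transitively ordered triple $\langle x,y,z\rangle$ of distinct points is regarded as containing the ordered pairs $(x,y)$, $(y,z)$, $(x,z)$. A directed triple system of order $n$, DTS($n$), is a pair $(V,\mathcal{B})$ where $V$ is a set of $n$ points and $\mathcal{B}$ is a collection of transitively ordered triples of distinct points of $V$ such that every ordered pair of distinct points of $V$ is contained in precisely one triple of $\mathcal{B}$. Given a DTS($n$), define a binary operation on $V$ by $x\cdot x=x$ and, for $x\neq y$, $x\cdot y=z$ where $z$ is the third element of the unique triple of $\mathcal{B}$ containing the ordered pair $(x,y)$. The DTS($n$) is called a Latin directed triple system, LDTS($n$), if $(V,\cdot)$ is a quasigroup, i.e. if its operation table is a Latin square. An LDTS($n$) is flexible if this quasigroup satisfies the flexible law $x\cdot(y\cdot x)=(x\cdot y)\cdot x$ for all $x,y\in V$. *)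

theory Defs
  imports Main
begin

text \<open>The triple \<open>(x, y, z)\<close> stands for the transitively ordered triple
  \<open>\<langle>x, y, z\<rangle>\<close>.\<close>

type_synonym 'a ttriple = "'a \<times> 'a \<times> 'a"

fun points :: "'a ttriple \<Rightarrow> 'a set" where
  "points (x, y, z) = {x, y, z}"

fun ordered_pairs :: "'a ttriple \<Rightarrow> ('a \<times> 'a) set" where
  "ordered_pairs (x, y, z) = {(x, y), (y, z), (x, z)}"

fun distinct_triple :: "'a ttriple \<Rightarrow> bool" where
  "distinct_triple (x, y, z) \<longleftrightarrow> x \<noteq> y \<and> y \<noteq> z \<and> x \<noteq> z"

text \<open>The blocks form a set: a repeated block would cover its ordered pairs twice, so
  allowing multiplicities would give no further systems.\<close>

definition directed_triple_system :: "nat \<Rightarrow> 'a set \<Rightarrow> 'a ttriple set \<Rightarrow> bool" where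
  "directed_triple_system n V B \<longleftrightarrow>
     finite V \<and> card V = n \<and>
     (\<forall>t\<in>B. distinct_triple t \<and> points t \<subseteq> V) \<and>
     (\<forall>x\<in>V. \<forall>y\<in>V. x \<noteq> y \<longrightarrow> (\<exists>!t. t \<in> B \<and> (x, y) \<in> ordered_pairs t))"

text \<open>For distinct points \<open>x\<close>, \<open>y\<close> of a directed triple system both descriptions below are
  uniquely satisfied; for other arguments the value is irrelevant.\<close>

definition block_of :: "'a ttriple set \<Rightarrow> 'a \<Rightarrow> 'a \<Rightarrow> 'a ttriple" where
  "block_of B x y = (THE t. t \<in> B \<and> (x, y) \<in> ordered_pairs t)"

definition dts_op :: "'a ttriple set \<Rightarrow> 'a \<Rightarrow> 'a \<Rightarrow> 'a" where
  "dts_op B x y =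
     (if x = y then x else (THE z. z \<in> points (block_of B x y) \<and> z \<noteq> x \<and> z \<noteq> y))"

definition quasigroup_on :: "'a set \<Rightarrow> ('a \<Rightarrow> 'a \<Rightarrow> 'a) \<Rightarrow> bool" where
  "quasigroup_on V f \<longleftrightarrow>
     (\<forall>x\<in>V. \<forall>y\<in>V. f x y \<in> V) \<and>
     (\<forall>a\<in>V. \<forall>b\<in>V. (\<exists>!x. x \<in> V \<and> f a x = b) \<and> (\<exists>!y. y \<in> V \<and> f y a = b))"

definition latin_dts :: "nat \<Rightarrow> 'a set \<Rightarrow> 'a ttriple set \<Rightarrow> bool" where
  "latin_dts n V B \<longleftrightarrow> directed_triple_system n V B \<and> quasigroup_on V (dts_op B)"

definition flexible_ldts :: "nat \<Rightarrow> 'a set \<Rightarrow> 'a ttriple set \<Rightarrow> bool" where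
  "flexible_ldts n V B \<longleftrightarrow> latin_dts n V B \<and>
     (\<forall>x\<in>V. \<forall>y\<in>V. dts_op B x (dts_op B y x) = dts_op B (dts_op B x y) x)"

end

(* A directed triple system is Latin and flexible iff every block (x,y,z) comes with points u, w
   such that (w,y,x), (x,u,w), (z,u,x) are blocks.  Hence the edges of the complete graph split into
   triangles {a,b,c}, carrying the blocks (a,b,c), (c,b,a), and bipyramids with poles p, q and a rim
   cycle c_1 ... c_k, carrying the blocks (c_i,p,c_{i+1}), (c_{i+1},q,c_i).

   Existence: such decompositions with a hole of size 3 or 4 are tripled with the Latin square of
   addition modulo g, starting from finitely many designs found by computer search.

   Non-existence: a point y is the middle of blocks on n - 1 - 2m other points, so for even n it is a
   pole of an odd number of bipyramids with odd rim.  There are thus at least n/2 of these, each with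
   3k >= 9 of the n(n-1)/2 edges; this forces n >= 10, and the cases n = 10, 12 are excluded by
   counting the degrees in the graph of the remaining edges. *)

theory Submission
  imports Defs "HOL-Library.Multiset"
begin

section \<open>Decompositions into triangles and bipyramids\<close>

text \<open>Tripling produces n = 3v - 2w points, and v itself has to be 0 or 1 modulo 3, so n + 2w
  must be 0 or 3 modulo 9. Among w = 0, 1, 3, 4 this leaves only w = 3 for n = 6 modulo 9 and only w
  = 4 for n = 4 modulo 9; hence holes of both sizes are carried along. A hole of 3 points is finally
  filled by a triangle; a hole of 4 points cannot be filled, since order 4 is excluded, and serves
  only as a common part. As v and n have the same parity, the missing orders 6, 10, 12 block the
  tripling for the even orders 16, 18, 22, 24, 28, 30, 34, 36, which need designs of their own. The
  order 12 is the delicate exclusion: the odd bipyramids may leave out up to 12 of the 66 edges.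
  Their total rim length can a priori be 18, 20, 21 or 22, and each value needs its own
  contradiction.\<close>

definition pairs :: "'a set \<Rightarrow> ('a \<times> 'a) set" where
  "pairs V = {(x, y). x \<in> V \<and> y \<in> V \<and> x \<noteq> y}"

text \<open>The last condition is the Latin and the flexible law together: \<open>y\<close> and \<open>u\<close> are the two poles
  of a bipyramid with \<open>w, x, z\<close> consecutive on its rim; for a triangle \<open>u = y\<close> and \<open>w = z\<close>.\<close>

definition flexible_blocks :: "('a \<times> 'a) set \<Rightarrow> 'a ttriple set \<Rightarrow> bool" where
  "flexible_blocks E B \<longleftrightarrow>
     (\<forall>t\<in>B. distinct_triple t \<and> ordered_pairs t \<subseteq> E) \<and>
     (\<forall>e\<in>E. \<exists>!t. t \<in> B \<and> e \<in> ordered_pairs t) \<and>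
     (\<forall>x y z. (x, y, z) \<in> B \<longrightarrow> (\<exists>u w. (w, y, x) \<in> B \<and> (x, u, w) \<in> B \<and> (z, u, x) \<in> B))"

definition decomposable :: "('a \<times> 'a) set \<Rightarrow> bool" where
  "decomposable E \<longleftrightarrow> (\<exists>B. flexible_blocks E B)"

lemma flexible_blocksD:
  assumes "flexible_blocks E B"
  shows "t \<in> B \<Longrightarrow> distinct_triple t"
    and "t \<in> B \<Longrightarrow> ordered_pairs t \<subseteq> E"
    and "e \<in> E \<Longrightarrow> \<exists>!t. t \<in> B \<and> e \<in> ordered_pairs t"
    and "(x, y, z) \<in> B \<Longrightarrow> \<exists>u w. (w, y, x) \<in> B \<and> (x, u, w) \<in> B \<and> (z, u, x) \<in> B"
  using assms unfolding flexible_blocks_def by simp_all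

lemma flexible_blocks_unique:
  assumes "flexible_blocks E B" "s \<in> B" "t \<in> B" "e \<in> ordered_pairs s" "e \<in> ordered_pairs t"
  shows "s = t"
proof -
  have "e \<in> E" using flexible_blocksD(2)[OF assms(1,2)] assms(4) by (rule subsetD)
  then show ?thesis using flexible_blocksD(3)[OF assms(1)] assms(2-5) by (metis (no_types))
qed

lemma decomposable_empty: "decomposable {}"
  unfolding decomposable_def flexible_blocks_def by (rule exI[of _ "{}"]) simp

text \<open>The last condition of \<open>flexible_blocks\<close> relates a block only to blocks of
  the same decomposition, so edge-disjoint decompositions can be put together without
  interaction.\<close>

lemma decomposable_Un:
  assumes "decomposable E" "decomposable F" "E \<inter> F = {}"
  shows "decomposable (E \<union> F)"
proof -
  obtain A B where A: "flexible_blocks E A" and B: "flexible_blocks F B"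
    using assms unfolding decomposable_def by blast
  have "\<exists>!t. t \<in> A \<union> B \<and> e \<in> ordered_pairs t" if e: "e \<in> E \<union> F" for e
  proof (cases "e \<in> E")
    case True
    then have "t \<notin> B" if "e \<in> ordered_pairs t" for t
      using flexible_blocksD(2)[OF B, of t] that assms(3) by blast
    then have "t \<in> A \<union> B \<and> e \<in> ordered_pairs t \<longleftrightarrow> t \<in> A \<and> e \<in> ordered_pairs t" for t
      by blast
    then show ?thesis using flexible_blocksD(3)[OF A True] by simp
  next
    case False
    then have "t \<notin> A" if "e \<in> ordered_pairs t" for t
      using flexible_blocksD(2)[OF A, of t] that by blast
    then have "t \<in> A \<union> B \<and> e \<in> ordered_pairs t \<longleftrightarrow> t \<in> B \<and> e \<in> ordered_pairs t" for t
      by blast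
    moreover have "e \<in> F" using e False by blast
    ultimately show ?thesis using flexible_blocksD(3)[OF B] by simp
  qed
  moreover have "distinct_triple t \<and> ordered_pairs t \<subseteq> E \<union> F" if "t \<in> A \<union> B" for t
    using that flexible_blocksD(1,2)[OF A, of t] flexible_blocksD(1,2)[OF B, of t] by blast
  moreover have "\<exists>u w. (w, y, x) \<in> A \<union> B \<and> (x, u, w) \<in> A \<union> B \<and> (z, u, x) \<in> A \<union> B"
    if "(x, y, z) \<in> A \<union> B" for x y z
    using that flexible_blocksD(4)[OF A, of x y z] flexible_blocksD(4)[OF B, of x y z] by auto
  ultimately have "flexible_blocks (E \<union> F) (A \<union> B)"
    unfolding flexible_blocks_def by simp
  then show ?thesis unfolding decomposable_def by blast
qed

lemma decomposable_UN:
  assumes "finite I" "\<And>i. i \<in> I \<Longrightarrow> decomposable (E i)"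
    and "\<And>i j. i \<in> I \<Longrightarrow> j \<in> I \<Longrightarrow> i \<noteq> j \<Longrightarrow> E i \<inter> E j = {}"
  shows "decomposable (\<Union>i\<in>I. E i)"
  using assms
proof (induction I rule: finite_induct)
  case empty
  then show ?case by (simp add: decomposable_empty)
next
  case (insert i I)
  have "E i \<inter> (\<Union>j\<in>I. E j) = {}" using insert.prems(2) insert.hyps by blast
  with insert show ?case by (simp add: decomposable_Un)
qed

lemma decomposable_image:
  assumes "decomposable E" "inj_on f V" "E \<subseteq> V \<times> V"
  shows "decomposable (map_prod f f ` E)"
proof -
  define g where "g = (\<lambda>(x, y, z). (f x, f y, f z))"
  have g: "g (x, y, z) = (f x, f y, f z)" for x y z by (simp add: g_def)
  have og: "ordered_pairs (g t) = map_prod f f ` ordered_pairs t" for t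
    by (cases t) (simp add: g)
  have fe: "f x = f y \<longleftrightarrow> x = y" if "x \<in> V" "y \<in> V" for x y using assms(2) that by (meson inj_onD)
  obtain A where A: "flexible_blocks E A" using assms unfolding decomposable_def by blast
  have AV: "x \<in> V \<and> y \<in> V \<and> z \<in> V" if "(x, y, z) \<in> A" for x y z
    using flexible_blocksD(2)[OF A that] assms(3) by auto
  have im: "inj_on (map_prod f f) (V \<times> V)"
    using assms(2) by (intro map_prod_inj_on)
  have 1: "distinct_triple t \<and> ordered_pairs t \<subseteq> map_prod f f ` E" if t: "t \<in> g ` A" for t
  proof -
    obtain s where s: "s \<in> A" "t = g s" using t by blast
    have "distinct_triple t" using flexible_blocksD(1)[OF A s(1)] s AV by (cases s) (auto simp: g fe)
    moreover have "ordered_pairs s \<subseteq> E" using flexible_blocksD(2)[OF A s(1)] .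
    ultimately show ?thesis using s(2) og by auto
  qed
  have 2: "\<exists>!t. t \<in> g ` A \<and> e \<in> ordered_pairs t" if e: "e \<in> map_prod f f ` E" for e
  proof -
    obtain e' where e': "e' \<in> E" "e = map_prod f f e'" using e by (metis imageE)
    have mem: "e \<in> ordered_pairs (g t) \<longleftrightarrow> e' \<in> ordered_pairs t" if "t \<in> A" for t
      unfolding og e'(2) by (rule inj_on_image_mem_iff[OF im])
        (use e'(1) assms(3) flexible_blocksD(2)[OF A that] in auto)
    obtain s where s: "s \<in> A" "e' \<in> ordered_pairs s"
      using ex1_implies_ex[OF flexible_blocksD(3)[OF A e'(1)]] by (elim exE conjE)
    have u: "t = s" if "t \<in> A" "e' \<in> ordered_pairs t" for t
      using flexible_blocks_unique[OF A that(1) s(1) that(2) s(2)] .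
    show ?thesis
    proof (rule ex1I[of _ "g s"])
      show "g s \<in> g ` A \<and> e \<in> ordered_pairs (g s)" using s mem by simp
      show "t = g s" if "t \<in> g ` A \<and> e \<in> ordered_pairs t" for t
        using that u mem by (metis imageE)
    qed
  qed
  have 3: "\<exists>u w. (w, y, x) \<in> g ` A \<and> (x, u, w) \<in> g ` A \<and> (z, u, x) \<in> g ` A"
    if t: "(x, y, z) \<in> g ` A" for x y z
  proof -
    obtain s where "s \<in> A" "g s = (x, y, z)" using t by (metis imageE)
    then obtain x' y' z' where s: "(x', y', z') \<in> A" "g (x', y', z') = (x, y, z)"
      by (cases s) auto
    then obtain u w where "(w, y', x') \<in> A" "(x', u, w) \<in> A" "(z', u, x') \<in> A"
      using flexible_blocksD(4)[OF A] by blast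
    then have "g (w, y', x') \<in> g ` A" "g (x', u, w) \<in> g ` A" "g (z', u, x') \<in> g ` A"
      by (simp_all only: imageI)
    then show ?thesis using s(2) unfolding g by auto
  qed
  have "flexible_blocks (map_prod f f ` E) (g ` A)"
    unfolding flexible_blocks_def by (intro conjI allI impI ballI 1 2 3) (use 1 in auto)
  then show ?thesis unfolding decomposable_def by blast
qed

text \<open>A triangle is a list of length 3; a list of length 5 or 7 consists of the two poles of a
  bipyramid followed by its rim.\<close>

fun cell_edges :: "'a list \<Rightarrow> ('a \<times> 'a) list" where
  "cell_edges [a, b, c] = [(a, b), (b, c), (c, a)]"
| "cell_edges [p, q, a, b, c] =
     [(p, a), (p, b), (p, c), (q, a), (q, b), (q, c), (a, b), (b, c), (c, a)]"
| "cell_edges [p, q, a, b, c, d, e] =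
     [(p, a), (p, b), (p, c), (p, d), (p, e), (q, a), (q, b), (q, c), (q, d), (q, e),
      (a, b), (b, c), (c, d), (d, e), (e, a)]"
| "cell_edges _ = []"

definition arcs :: "('a \<times> 'a) list \<Rightarrow> ('a \<times> 'a) set" where
  "arcs es = set es \<union> (set es)\<inverse>"

text \<open>All quantifiers are bounded by \<open>B\<close> and \<open>E\<close> is a union over
  \<open>B\<close>, so that every premise can be evaluated for an explicit set of blocks.\<close>

lemma flexible_blocksI:
  assumes "\<forall>t\<in>B. distinct_triple t"
    and "E = (\<Union>t\<in>B. ordered_pairs t)"
    and "\<forall>s\<in>B. \<forall>t\<in>B. s = t \<or> ordered_pairs s \<inter> ordered_pairs t = {}"
    and "\<forall>(x, y, z)\<in>B. \<exists>(w, y', x')\<in>B. y' = y \<and> x' = x \<and>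
           (\<exists>(x', u, w')\<in>B. x' = x \<and> w' = w \<and> (z, u, x) \<in> B)"
  shows "flexible_blocks E B"
proof -
  have "\<exists>!t. t \<in> B \<and> e \<in> ordered_pairs t" if e: "e \<in> E" for e
  proof (rule ex_ex1I)
    show "\<exists>t. t \<in> B \<and> e \<in> ordered_pairs t" using e assms(2) by blast
    show "s = t" if "s \<in> B \<and> e \<in> ordered_pairs s" "t \<in> B \<and> e \<in> ordered_pairs t" for s t
      using that assms(3) by blast
  qed
  moreover have "\<exists>u w. (w, y, x) \<in> B \<and> (x, u, w) \<in> B \<and> (z, u, x) \<in> B"
    if "(x, y, z) \<in> B" for x y z using assms(4) that by fast
  ultimately show ?thesis using assms(1,2) unfolding flexible_blocks_def by blast
qed

lemma cell_edges_map: "cell_edges (map f c) = map (map_prod f f) (cell_edges c)"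
  by (cases c rule: cell_edges.cases) auto

lemma cell_edges_set: "e \<in> set (cell_edges c) \<Longrightarrow> fst e \<in> set c \<and> snd e \<in> set c"
  by (cases c rule: cell_edges.cases) auto

lemma cell_edges_Nil: "length c \<notin> {3, 5, 7} \<Longrightarrow> cell_edges c = []"
  by (cases c rule: cell_edges.cases) auto

text \<open>Only one labelled model of each kind of cell is checked by evaluation;
  \<open>decomposable_cell\<close> carries it over to arbitrary points along
  \<open>nth c\<close>.\<close>

lemma decomposable_cell_nat: "decomposable (arcs (cell_edges [0..<k]))"
proof -
  have "flexible_blocks (arcs (cell_edges [0, 1, 2])) {(0, 1, 2), (2, 1, 0 :: nat)}"
    apply (intro flexible_blocksI)
    subgoal by simp
    subgoal by code_simp
    subgoal by simp
    subgoal by simp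
    done
  moreover have "flexible_blocks (arcs (cell_edges [0, 1, 2, 3, 4]))
      {(2, 0, 3), (3, 0, 4), (4, 0, 2), (3, 1, 2), (4, 1, 3), (2, 1, 4 :: nat)}"
    apply (intro flexible_blocksI)
    subgoal by simp
    subgoal by code_simp
    subgoal by simp
    subgoal by simp
    done
  moreover have "flexible_blocks (arcs (cell_edges [0, 1, 2, 3, 4, 5, 6]))
      {(2, 0, 3), (3, 0, 4), (4, 0, 5), (5, 0, 6), (6, 0, 2),
       (3, 1, 2), (4, 1, 3), (5, 1, 4), (6, 1, 5), (2, 1, 6 :: nat)}"
    apply (intro flexible_blocksI)
    subgoal by simp
    subgoal by code_simp
    subgoal by simp
    subgoal by simp
    done
  moreover have "[0..<3] = [0, 1, 2]" "[0..<5] = [0, 1, 2, 3, 4]" "[0..<7] = [0, 1, 2, 3, 4, 5, 6]"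
    by (simp_all add: upt_rec)
  \<comment> \<open>All other lengths fall under the default equation of \<open>cell_edges\<close>
    and have no edges.\<close>
  moreover have "decomposable (arcs (cell_edges [0..<k]))" if "k \<notin> {3, 5, 7}"
    using cell_edges_Nil[of "[0..<k]"] that by (simp add: arcs_def decomposable_empty)
  ultimately show ?thesis unfolding decomposable_def by (metis insert_iff empty_iff)
qed

lemma decomposable_cell:
  assumes "distinct c"
  shows "decomposable (arcs (cell_edges c))"
proof -
  let ?f = "nth c" and ?c = "[0..<length c]"
  have "arcs (cell_edges (map ?f ?c)) = map_prod ?f ?f ` arcs (cell_edges ?c)"
    unfolding cell_edges_map arcs_def by force
  moreover have "decomposable (map_prod ?f ?f ` arcs (cell_edges ?c))"
  proof (rule decomposable_image[OF decomposable_cell_nat])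
    show "inj_on ?f {..<length c}" using assms by (simp add: inj_on_nth)
    show "arcs (cell_edges ?c) \<subseteq> {..<length c} \<times> {..<length c}"
      using cell_edges_set[of _ ?c] unfolding arcs_def by fastforce
  qed
  ultimately show ?thesis by (simp add: map_nth)
qed

text \<open>An edge between points of \<open>{0..<64}\<close> is encoded by a single number, independently of its
  orientation.\<close>

definition edge_code :: "int \<times> int \<Rightarrow> int" where
  "edge_code = (\<lambda>(a, b). if a < b then 64 * b + a else 64 * a + b)"

text \<open>An edge lies outside the hole of the points below h iff its larger end b is at least h.
  The order of enumeration makes the codes increase, so this is the list that a sort of the codes
  should return.\<close>

definition all_edges :: "int \<Rightarrow> int \<Rightarrow> (int \<times> int) list" where
  "all_edges n h = concat (map (\<lambda>b. map (\<lambda>a. (a, b)) [0..b - 1]) [h..n - 1])"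

text \<open>The output of the merge sort is compared with a concrete list, so that only the preservation of
  the multiset of elements matters.\<close>

fun merge :: "int list \<Rightarrow> int list \<Rightarrow> int list" where
  "merge (x # xs) (y # ys) = (if x \<le> y then x # merge xs (y # ys) else y # merge (x # xs) ys)"
| "merge [] ys = ys"
| "merge xs [] = xs"

fun merge_adjacent :: "int list list \<Rightarrow> int list list" where
  "merge_adjacent (xs # ys # zss) = merge xs ys # merge_adjacent zss"
| "merge_adjacent xss = xss"

lemma length_merge_adjacent: "length (merge_adjacent xss) \<le> length xss"
  by (induction xss rule: merge_adjacent.induct) auto

function merge_all :: "int list list \<Rightarrow> int list" where
  "merge_all [] = []"
| "merge_all [xs] = xs"
| "merge_all (xs # ys # zss) = merge_all (merge xs ys # merge_adjacent zss)"
  by pat_completeness auto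
termination
  by (relation "measure length") (auto intro: le_less_trans[OF length_merge_adjacent])

lemma mset_merge: "mset (merge xs ys) = mset xs + mset ys"
  by (induction xs ys rule: merge.induct) auto

lemma mset_merge_adjacent: "mset (concat (merge_adjacent xss)) = mset (concat xss)"
  by (induction xss rule: merge_adjacent.induct) (auto simp: mset_merge)

lemma mset_merge_all: "mset (merge_all xss) = mset (concat xss)"
proof (induction xss rule: merge_all.induct)
  case (3 xs ys zss)
  then show ?case using mset_merge_adjacent[of zss] by (simp add: mset_merge)
qed auto

definition valid_design :: "int \<Rightarrow> int \<Rightarrow> int list list \<Rightarrow> bool" where
  "valid_design n h cs \<longleftrightarrow> 0 \<le> h \<and> h \<le> n \<and> n \<le> 64 \<and>
     list_all (\<lambda>c. distinct c \<and> list_all (\<lambda>x. 0 \<le> x \<and> x < n) c) cs \<and>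
     merge_all (map (\<lambda>e. [edge_code e]) (concat (map cell_edges cs))) = map edge_code (all_edges n h)"

section \<open>Complete graphs with a hole\<close>

definition hole_decomposable :: "nat \<Rightarrow> nat \<Rightarrow> bool" where
  "hole_decomposable n h \<longleftrightarrow> (\<forall>(V :: nat set) W. finite V \<and> card V = n \<and> W \<subseteq> V \<and> card W = h \<longrightarrow>
     decomposable (pairs V - pairs W))"

lemma pairs_subset: "pairs V \<subseteq> V \<times> V"
  by (auto simp: pairs_def)

lemma edge_code_swap: "edge_code (a, b) = edge_code (b, a)"
  by (auto simp: edge_code_def)

lemma edge_code_inj:
  assumes "edge_code (a, b) = edge_code (c, d)"
    "0 \<le> a" "a < 64" "0 \<le> b" "b < 64" "0 \<le> c" "c < 64" "0 \<le> d" "d < 64"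
  shows "a = c \<and> b = d \<or> a = d \<and> b = c"
proof -
  have dm: "edge_code (x, y) div 64 = max x y \<and> edge_code (x, y) mod 64 = min x y"
    if "0 \<le> x" "x < 64" "0 \<le> y" "y < 64" for x y
    using that by (auto simp: edge_code_def)
  have "max a b = max c d" "min a b = min c d"
    using dm[of a b] dm[of c d] assms by metis+
  then show ?thesis by (auto simp: max_def min_def split: if_splits)
qed

lemma set_all_edges:
  assumes "0 \<le> h"
  shows "set (all_edges n h) = {(a, b). 0 \<le> a \<and> a < b \<and> h \<le> b \<and> b < n}"
  using assms by (auto simp: all_edges_def)

lemma distinct_all_edges: "distinct (all_edges n h)"
proof -
  have "distinct (concat (map (\<lambda>b. map (\<lambda>a. (a, b)) [0..b - 1]) bs))" if "distinct bs" for bs :: "int list"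
    using that by (induction bs) (auto simp: distinct_map inj_on_def)
  then show ?thesis unfolding all_edges_def by simp
qed

text \<open>As \<open>edge_code\<close> ignores orientation, distinct codes over the whole list mean
  that no two cells share an edge in either direction.\<close>

lemma decomposable_cells:
  assumes "\<forall>c\<in>set cs. distinct c" "distinct (map edge_code (concat (map cell_edges cs)))"
  shows "decomposable (arcs (concat (map cell_edges cs)))"
  using assms
proof (induction cs)
  case Nil
  then show ?case by (simp add: arcs_def decomposable_empty)
next
  case (Cons c cs)
  have ac: "edge_code e \<in> edge_code ` set es" if "e \<in> arcs es" for e and es :: "(int \<times> int) list"
  proof -
    obtain a b where e: "e = (a, b)" by (cases e)
    then have "(a, b) \<in> set es \<or> (b, a) \<in> set es" using that by (simp add: arcs_def)
    then show ?thesis using edge_code_swap[of a b] e by (metis imageI)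
  qed
  have "arcs (cell_edges c) \<inter> arcs (concat (map cell_edges cs)) = {}"
    using Cons.prems(2) ac[of _ "cell_edges c"] ac[of _ "concat (map cell_edges cs)"]
    unfolding map_append concat.simps list.map distinct_append set_map by fast
  then have "decomposable (arcs (cell_edges c) \<union> arcs (concat (map cell_edges cs)))"
    using Cons by (intro decomposable_Un decomposable_cell) auto
  moreover have "arcs (concat (map cell_edges (c # cs)))
      = arcs (cell_edges c) \<union> arcs (concat (map cell_edges cs))"
    by (auto simp: arcs_def)
  ultimately show ?case by simp
qed

text \<open>Relabelling a design must carry its hole to the prescribed hole, so a bijection of the
  subsets is glued to one of the complements.\<close>

lemma ex_bij_nested:
  assumes "finite A" "finite B" "A' \<subseteq> A" "B' \<subseteq> B" "card A = card B" "card A' = card B'"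
  shows "\<exists>f. bij_betw f A B \<and> f ` A' = B'"
proof -
  have fin: "finite A'" "finite B'" using assms finite_subset by blast+
  obtain f where f: "bij_betw f A' B'"
    using finite_same_card_bij[OF fin assms(6)] by blast
  have "card (A - A') = card (B - B')"
    using assms fin by (simp add: card_Diff_subset)
  then obtain g where g: "bij_betw g (A - A') (B - B')"
    using finite_same_card_bij assms(1,2) by blast
  \<comment> \<open>The two sums of \<open>?h i\<close> and \<open>3 * tau i + 2 * pi i\<close> agree, hence so do all their terms.\<close>
  let ?h = "\<lambda>x. if x \<in> A' then f x else g x"
  have "bij_betw ?h (A' \<union> (A - A')) (B' \<union> (B - B'))"
  proof (rule bij_betw_combine)
    show "bij_betw ?h A' B'" using f by (subst bij_betw_cong[of _ _ f]) auto
    show "bij_betw ?h (A - A') (B - B')" using g by (subst bij_betw_cong[of _ _ g]) auto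
  qed blast
  moreover have "A' \<union> (A - A') = A" "B' \<union> (B - B') = B" using assms by blast+
  moreover have "?h ` A' = B'" using f by (simp add: bij_betw_def)
  ultimately show ?thesis by metis
qed

text \<open>The test gives equality of two multisets of codes. The codes of \<open>all_edges\<close>
  are distinct, hence the cells use every edge outside the hole exactly once and no other
  edge.\<close>

lemma hole_decomposable_valid_design:
  assumes "valid_design n h cs"
  shows "hole_decomposable (nat n) (nat h)"
proof -
  let ?es = "concat (map cell_edges cs)"
  have h: "0 \<le> h" "h \<le> n" "n \<le> 64"
    and cs: "\<forall>c\<in>set cs. distinct c \<and> (\<forall>x\<in>set c. 0 \<le> x \<and> x < n)"
    and s: "merge_all (map (\<lambda>e. [edge_code e]) ?es) = map edge_code (all_edges n h)"
    using assms unfolding valid_design_def list_all_iff by auto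
  have inj: "inj_on edge_code (set (all_edges n h))"
    using h(3) unfolding set_all_edges[OF h(1)] inj_on_def
    by (auto dest!: edge_code_inj)
  have ms: "mset (map edge_code ?es) = mset (map edge_code (all_edges n h))"
    using mset_merge_all[of "map (\<lambda>e. [edge_code e]) ?es"] unfolding s concat_map_singleton by simp
  have "distinct (map edge_code (all_edges n h))"
    using inj distinct_all_edges by (simp add: distinct_map)
  then have dist: "distinct (map edge_code ?es)"
    using mset_eq_imp_distinct_iff[OF ms] by simp
  have set_eq: "edge_code ` set ?es = edge_code ` set (all_edges n h)"
    using mset_eq_setD[OF ms] by (simp only: set_map)
  have range: "0 \<le> fst e \<and> fst e < n \<and> 0 \<le> snd e \<and> snd e < n" if "e \<in> set ?es" for e
    using that cs cell_edges_set by fastforce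
  have arcs: "arcs ?es = pairs {0..<n} - pairs {0..<h}" (is "_ = ?R")
  proof (rule set_eqI, clarify)
    fix a b
    have "(a, b) \<in> arcs ?es \<longleftrightarrow> (a, b) \<in> set ?es \<or> (b, a) \<in> set ?es"
      by (simp add: arcs_def)
    also have "\<dots> \<longleftrightarrow> 0 \<le> a \<and> a < n \<and> 0 \<le> b \<and> b < n \<and> edge_code (a, b) \<in> edge_code ` set ?es"
    proof
      assume "(a, b) \<in> set ?es \<or> (b, a) \<in> set ?es"
      then show "0 \<le> a \<and> a < n \<and> 0 \<le> b \<and> b < n \<and> edge_code (a, b) \<in> edge_code ` set ?es"
        using range[of "(a, b)"] range[of "(b, a)"] edge_code_swap[of a b] by (metis fst_conv image_eqI snd_conv)
    next
      assume *: "0 \<le> a \<and> a < n \<and> 0 \<le> b \<and> b < n \<and> edge_code (a, b) \<in> edge_code ` set ?es"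
      then obtain c d where cd: "(c, d) \<in> set ?es" "edge_code (a, b) = edge_code (c, d)" by auto
      with edge_code_inj[OF cd(2)] range[OF cd(1)] * h(3) show "(a, b) \<in> set ?es \<or> (b, a) \<in> set ?es"
        by auto
    qed
    also have "\<dots> \<longleftrightarrow> 0 \<le> a \<and> a < n \<and> 0 \<le> b \<and> b < n \<and>
        edge_code (a, b) \<in> edge_code ` {(a, b). 0 \<le> a \<and> a < b \<and> h \<le> b \<and> b < n}"
      unfolding set_eq set_all_edges[OF h(1)] by (rule refl)
    also have "\<dots> \<longleftrightarrow> (a, b) \<in> ?R"
    proof
      assume *: "0 \<le> a \<and> a < n \<and> 0 \<le> b \<and> b < n \<and>
        edge_code (a, b) \<in> edge_code ` {(a, b). 0 \<le> a \<and> a < b \<and> h \<le> b \<and> b < n}"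
      then obtain c d where cd: "0 \<le> c" "c < d" "h \<le> d" "d < n" "edge_code (a, b) = edge_code (c, d)" by auto
      with edge_code_inj[OF cd(5)] * h(3) show "(a, b) \<in> ?R" by (auto simp: pairs_def)
    next
      assume *: "(a, b) \<in> ?R"
      then have "(a, b) \<in> {(a, b). 0 \<le> a \<and> a < b \<and> h \<le> b \<and> b < n} \<or> (b, a) \<in> {(a, b). 0 \<le> a \<and> a < b \<and> h \<le> b \<and> b < n}"
        by (auto simp: pairs_def)
      then have "edge_code (a, b) \<in> edge_code ` {(a, b). 0 \<le> a \<and> a < b \<and> h \<le> b \<and> b < n}"
        by (elim disjE) (rule imageI, assumption, subst edge_code_swap, rule imageI, assumption)
      with * show "0 \<le> a \<and> a < n \<and> 0 \<le> b \<and> b < n \<and>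
        edge_code (a, b) \<in> edge_code ` {(a, b). 0 \<le> a \<and> a < b \<and> h \<le> b \<and> b < n}"
        by (auto simp: pairs_def)
    qed
    finally show "(a, b) \<in> arcs ?es \<longleftrightarrow> (a, b) \<in> ?R" .
  qed
  have dec: "decomposable (pairs {0..<n} - pairs {0..<h})"
    using decomposable_cells[OF _ dist] cs arcs by simp
  show ?thesis unfolding hole_decomposable_def
  proof (intro allI impI, elim conjE)
    fix V W :: "nat set"
    assume V: "finite V" "card V = nat n" "W \<subseteq> V" "card W = nat h"
    obtain f where f: "bij_betw f {0..<n} V" "f ` {0..<h} = W"
      using ex_bij_nested[of "{0..<n}" V "{0..<h}" W] V h by auto
    have inj: "inj_on f {0..<n}" and im: "f ` {0..<n} = V" using f(1) by (auto simp: bij_betw_def)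
    have W: "f x \<in> W \<longleftrightarrow> x \<in> {0..<h}" if "x \<in> {0..<n}" for x
      using that inj_on_image_mem_iff[OF inj that, of "{0..<h}"] f(2) h by auto
    have "map_prod f f ` (pairs {0..<n} - pairs {0..<h}) = pairs V - pairs W"
    proof (rule set_eqI, clarify)
      fix a b
      show "(a, b) \<in> map_prod f f ` (pairs {0..<n} - pairs {0..<h}) \<longleftrightarrow> (a, b) \<in> pairs V - pairs W"
      proof
        assume "(a, b) \<in> map_prod f f ` (pairs {0..<n} - pairs {0..<h})"
        then obtain c d where "a = f c" "b = f d" "(c, d) \<in> pairs {0..<n} - pairs {0..<h}" by auto
        then show "(a, b) \<in> pairs V - pairs W"
          using W[of c] W[of d] im inj_onD[OF inj, of c d] unfolding pairs_def by auto
      next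
        assume *: "(a, b) \<in> pairs V - pairs W"
        then obtain c d where cd: "a = f c" "b = f d" "c \<in> {0..<n}" "d \<in> {0..<n}"
          using im by (auto simp: pairs_def)
        then have "(c, d) \<in> pairs {0..<n} - pairs {0..<h}"
          using * W[of c] W[of d] by (auto simp: pairs_def)
        then have "map_prod f f (c, d) \<in> map_prod f f ` (pairs {0..<n} - pairs {0..<h})"
          by (rule imageI)
        then show "(a, b) \<in> map_prod f f ` (pairs {0..<n} - pairs {0..<h})" using cd by simp
      qed
    qed
    then show "decomposable (pairs V - pairs W)"
      using decomposable_image[OF dec inj] pairs_subset[of "{0..<n}"] by (simp add: subset_trans[OF Diff_subset])
  qed
qed

section \<open>Tripling\<close>

text \<open>The arcs of the complete tripartite graph with classes A, B, C.\<close>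

definition cross :: "'a set \<Rightarrow> 'a set \<Rightarrow> 'a set \<Rightarrow> ('a \<times> 'a) set" where
  "cross A B C = A \<times> B \<union> B \<times> A \<union> B \<times> C \<union> C \<times> B \<union> A \<times> C \<union> C \<times> A"

text \<open>For triangles with one vertex in each of three disjoint classes, a common arc joins the
  same two classes in both, so two corresponding vertices agree.\<close>

lemma triangle_arcs_meet:
  assumes "e \<in> {(a, b), (b, a), (b, c), (c, b), (c, a), (a, c)}"
    and "e \<in> {(a', b'), (b', a'), (b', c'), (c', b'), (c', a'), (a', c')}"
    and "a \<noteq> b'" "a \<noteq> c'" "b \<noteq> a'" "b \<noteq> c'" "c \<noteq> a'" "c \<noteq> b'"
  shows "a = a' \<and> b = b' \<or> b = b' \<and> c = c' \<or> a = a' \<and> c = c'"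
  using assms by (cases e) auto

text \<open>Rows, columns and symbols of the addition table modulo g index the three classes, and
  each entry of the table is a triangle. Two of the three coordinates determine the third, so every
  edge lies in exactly one triangle.\<close>

lemma decomposable_cross:
  fixes g :: nat
  assumes f: "bij_betw f {..<g} A" "bij_betw f' {..<g} B" "bij_betw f'' {..<g} C"
    and disj: "A \<inter> B = {}" "A \<inter> C = {}" "B \<inter> C = {}"
  shows "decomposable (cross A B C)"
proof -
  define T where "T = (\<lambda>(i, j). arcs (cell_edges [f i, f' j, f'' ((i + j) mod g)]))"
  let ?I = "{..<g} \<times> {..<g}"
  have mem: "f i \<in> A" "f' i \<in> B" "f'' i \<in> C" if "i < g" for i
    using f that by (auto simp: bij_betw_def)
  have inj: "f i = f j \<longleftrightarrow> i = j" "f' i = f' j \<longleftrightarrow> i = j" "f'' i = f'' j \<longleftrightarrow> i = j"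
    if "i < g" "j < g" for i j
    using f that by (auto simp: bij_betw_def inj_on_def)
  have ne: "f i \<noteq> f' j" "f i \<noteq> f'' j" "f' i \<noteq> f'' j" if "i < g" "j < g" for i j
    using mem that disj by (metis IntI empty_iff)+
  have T_eq: "T (i, j) = {(f i, f' j), (f' j, f i), (f' j, f'' k), (f'' k, f' j), (f'' k, f i), (f i, f'' k)}"
    if "k = (i + j) mod g" for i j k
    using that by (auto simp: T_def arcs_def)
  have mod_le: "i' \<le> i" if "(i + j) mod g = (i' + j) mod g" "i' < g" for i i' j :: nat
  proof (rule ccontr)
    assume "\<not> i' \<le> i"
    then have "g dvd i' + j - (i + j)"
      using that by (intro mod_eq_dvd_iff_nat[THEN iffD1]) auto
    then have "g \<le> i' - i" using \<open>\<not> i' \<le> i\<close> by (intro dvd_imp_le) auto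
    then show False using \<open>\<not> i' \<le> i\<close> that by simp
  qed
  have mod_inj: "i = i'" if "(i + j) mod g = (i' + j) mod g" "i < g" "i' < g" for i i' j :: nat
    using mod_le[OF that(1,3)] mod_le[OF that(1)[symmetric] that(2)] by simp
  have "decomposable (\<Union>p\<in>?I. T p)"
  proof (rule decomposable_UN)
    show "decomposable (T p)" if pI: "p \<in> ?I" for p
    proof -
      obtain i j where p: "p = (i, j)" "i < g" "j < g" using pI by auto
      then have "distinct [f i, f' j, f'' ((i + j) mod g)]" using ne by simp
      then show ?thesis unfolding p(1) T_def prod.case by (rule decomposable_cell)
    qed
    show "T p \<inter> T q = {}" if pq: "p \<in> ?I" "q \<in> ?I" "p \<noteq> q" for p q
    proof -
      obtain i j where p: "p = (i, j)" "i < g" "j < g" using pq by auto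
      obtain i' j' where q: "q = (i', j')" "i' < g" "j' < g" using pq by auto
      define k k' where "k = (i + j) mod g" and "k' = (i' + j') mod g"
      have k: "k < g" "k' < g" using p by (auto simp: k_def k'_def)
      have *: "k = k' \<Longrightarrow> i = i' \<Longrightarrow> j = j'" "k = k' \<Longrightarrow> j = j' \<Longrightarrow> i = i'"
        using mod_inj[of i j i'] mod_inj[of j i j'] p q by (auto simp: k_def k'_def add.commute)
      show ?thesis
      proof (rule ccontr)
        assume "T p \<inter> T q \<noteq> {}"
        then obtain e where "e \<in> T (i, j)" "e \<in> T (i', j')" unfolding p(1) q(1) by blast
        then have "f i = f i' \<and> f' j = f' j' \<or> f' j = f' j' \<and> f'' k = f'' k' \<or> f i = f i' \<and> f'' k = f'' k'"
          unfolding T_eq[OF k_def] T_eq[OF k'_def]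
          by (rule triangle_arcs_meet[OF _ _ ne(1)[OF p(2) q(3)] ne(2)[OF p(2) k(2)]
            ne(1)[OF q(2) p(3), symmetric] ne(3)[OF p(3) k(2)] ne(2)[OF q(2) k(1), symmetric]
            ne(3)[OF q(3) k(1), symmetric]])
        then have "i = i' \<and> j = j' \<or> j = j' \<and> k = k' \<or> i = i' \<and> k = k'"
          using inj(1)[OF p(2) q(2)] inj(2)[OF p(3) q(3)] inj(3)[OF k] by blast
        then show False using * pq(3) p(1) q(1) by blast
      qed
    qed
  qed auto
  moreover have "(\<Union>p\<in>?I. T p) = cross A B C"
  proof
    show "(\<Union>p\<in>?I. T p) \<subseteq> cross A B C"
      using mem by (auto simp: T_eq[OF refl] cross_def)
    define X where "X = (\<Union>p\<in>?I. T p)"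
    have sub: "(f i, f' j) \<in> X \<and> (f' j, f i) \<in> X \<and> (f i, f'' j) \<in> X \<and> (f'' j, f i) \<in> X \<and>
      (f' i, f'' j) \<in> X \<and> (f'' j, f' i) \<in> X" if ij: "i < g" "j < g" for i j
    proof -
      \<comment> \<open>This is j - i modulo g, written without a truncated difference. Entry (i, l)
        covers the edge from \<open>f i\<close> to \<open>f'' j\<close>, entry (l, i) the one from
        \<open>f' i\<close> to \<open>f'' j\<close>.\<close>
      define l where "l = (j + (g - i)) mod g"
      have l: "l < g" "j = (i + l) mod g" "j = (l + i) mod g"
        using ij by (auto simp: l_def mod_simps)
      have "T (i, j) \<subseteq> X" "T (i, l) \<subseteq> X" "T (l, i) \<subseteq> X" using ij l(1) by (auto simp: X_def)
      then show ?thesis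
        unfolding T_eq[OF refl, of i j] T_eq[OF l(2)] T_eq[OF l(3)] by simp
    qed
    have "A = f ` {..<g}" "B = f' ` {..<g}" "C = f'' ` {..<g}" using f by (auto simp: bij_betw_def)
    then have "cross A B C \<subseteq> X" unfolding cross_def by (auto simp: sub)
    then show "cross A B C \<subseteq> (\<Union>p\<in>?I. T p)" unfolding X_def .
  qed
  ultimately show ?thesis by simp
qed

lemma hole_decomposableD:
  fixes V :: "nat set"
  assumes "hole_decomposable n h" "finite V" "card V = n" "W \<subseteq> V" "card W = h"
  shows "decomposable (pairs V - pairs W)"
  using assms unfolding hole_decomposable_def by blast

text \<open>The \<open>n\<close> points are \<open>w\<close> common points and three groups of size \<open>v - w\<close>.  Each group
  together with the common points is decomposed with the common points as the hole, except for one
  group, where the hole is \<open>H\<close>.\<close>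

lemma hole_decomposable_triple:
  assumes vw: "hole_decomposable v w" and vh: "hole_decomposable v h" and "w \<le> v" "h \<le> v"
    and n: "n + 2 * w = 3 * v"
  shows "hole_decomposable n h"
  unfolding hole_decomposable_def
proof (intro allI impI, elim conjE)
  fix V H :: "nat set"
  assume V: "finite V" "card V = n" "H \<subseteq> V" "card H = h"
  define g where "g = v - w"
  have "v \<le> n" using assms by simp
  then obtain U where U: "H \<subseteq> U" "U \<subseteq> V" "card U = v"
    using exists_subset_between[of H v V] V assms(4) by metis
  \<comment> \<open>The common part W chosen next may meet H in any way: the edges inside U all come
    from the decomposition with hole H, those inside W being left out of the other groups.\<close>
  have finU: "finite U" using U V finite_subset by blast
  obtain W where W: "W \<subseteq> U" "card W = w" using obtain_subset_with_card_n[of w U] U assms by metis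
  have cVU: "card (V - U) = g + g"
    using U V finU assms by (simp add: card_Diff_subset g_def)
  obtain B where B: "B \<subseteq> V - U" "card B = g"
    using obtain_subset_with_card_n[of g "V - U"] cVU by auto
  define C where "C = V - U - B"
  define A where "A = U - W"
  have fin: "finite A" "finite B" "finite C" "finite W" using V finU finite_subset[OF B(1)] finite_subset[OF W(1)]
    by (auto simp: A_def C_def)
  have cC: "card C = g" using cVU B fin by (simp add: C_def card_Diff_subset)
  have cA: "card A = g" using U W fin by (simp add: A_def g_def card_Diff_subset)
  have bij: "\<exists>f. bij_betw f {..<g} X" if "finite X" "card X = g" for X :: "nat set"
    using that finite_same_card_bij[of "{..<g}" X] by simp
  have disj: "A \<inter> B = {}" "A \<inter> C = {}" "B \<inter> C = {}" "W \<inter> A = {}" "W \<inter> B = {}" "W \<inter> C = {}"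
    using B W by (auto simp: A_def C_def)
  have V_eq: "V = W \<union> A \<union> B \<union> C" and U_eq: "U = W \<union> A" using U W B by (auto simp: A_def C_def)
  have dc: "decomposable (cross A B C)"
    using decomposable_cross disj bij fin B(2) cA cC by metis
  have dU: "decomposable (pairs U - pairs H)"
    using hole_decomposableD[OF vh finU U(3,1)] V by simp
  have dB: "decomposable (pairs (W \<union> B) - pairs W)"
    using hole_decomposableD[OF vw, of "W \<union> B" W] fin B(2) W disj assms by (simp add: card_Un_disjoint g_def)
  have dC: "decomposable (pairs (W \<union> C) - pairs W)"
    using hole_decomposableD[OF vw, of "W \<union> C" W] fin cC W disj assms by (simp add: card_Un_disjoint g_def)
  have 1: "decomposable ((pairs (W \<union> B) - pairs W) \<union> (pairs (W \<union> C) - pairs W))"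
    using disj by (intro decomposable_Un dB dC) (auto simp: pairs_def)
  have 2: "decomposable ((pairs (W \<union> B) - pairs W) \<union> (pairs (W \<union> C) - pairs W) \<union> cross A B C)"
    using disj by (intro decomposable_Un 1 dc) (auto simp: pairs_def cross_def)
  have "decomposable (((pairs (W \<union> B) - pairs W) \<union> (pairs (W \<union> C) - pairs W) \<union> cross A B C)
      \<union> (pairs U - pairs H))"
  proof (rule decomposable_Un[OF 2 dU])
    have "(pairs (W \<union> B) - pairs W) \<inter> U \<times> U = {}" "(pairs (W \<union> C) - pairs W) \<inter> U \<times> U = {}"
      "cross A B C \<inter> U \<times> U = {}"
      using disj unfolding U_eq by (auto simp: pairs_def cross_def)
    then show "((pairs (W \<union> B) - pairs W) \<union> (pairs (W \<union> C) - pairs W) \<union> cross A B C)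
      \<inter> (pairs U - pairs H) = {}"
      using pairs_subset[of U] by blast
  qed
  moreover have "((pairs (W \<union> B) - pairs W) \<union> (pairs (W \<union> C) - pairs W) \<union> cross A B C)
      \<union> (pairs U - pairs H) = pairs V - pairs H"
    using disj U(1) unfolding U_eq V_eq by (auto simp: pairs_def cross_def)
  ultimately show "decomposable (pairs V - pairs H)" by simp
qed

section \<open>Small designs\<close>

text \<open>In the designs below the points are \<open>0, 1, \<dots>\<close>, and the first of them form the hole.\<close>

lemma hole_decomposable_7_3: "hole_decomposable 7 3"
proof -
  have "valid_design 7 3
    [[0, 3, 4], [0, 5, 6], [1, 3, 5], [1, 4, 6], [2, 3, 6], [2, 4, 5]]"
    by code_simp
  from hole_decomposable_valid_design[OF this] show ?thesis by simp
qed

lemma hole_decomposable_9_3: "hole_decomposable 9 3"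
proof -
  have "valid_design 9 3
    [[0, 3, 7], [0, 4, 8], [0, 5, 6], [1, 3, 5], [1, 4, 7], [1, 6, 8], [2, 3, 8], [2, 4, 5],
     [2, 6, 7], [3, 4, 6], [5, 7, 8]]"
    by code_simp
  from hole_decomposable_valid_design[OF this] show ?thesis by simp
qed

text \<open>The four hole points are the poles of two bipyramids, whose rims are the pentagon and
  the pentagram on the other five points.\<close>

lemma hole_decomposable_9_4: "hole_decomposable 9 4"
proof -
  have "valid_design 9 4
    [[0, 1, 4, 5, 6, 7, 8], [2, 3, 4, 6, 8, 5, 7]]"
    by code_simp
  from hole_decomposable_valid_design[OF this] show ?thesis by simp
qed

lemma hole_decomposable_13_3: "hole_decomposable 13 3"
proof -
  have "valid_design 13 3
    [[0, 3, 9], [0, 4, 12], [0, 5, 10], [0, 6, 11], [0, 7, 8], [1, 3, 11], [1, 4, 9], [1, 5,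
     8], [1, 6, 10], [1, 7, 12], [2, 3, 5], [2, 4, 8], [2, 6, 12], [2, 7, 10], [2, 9, 11],
     [3, 4, 10], [3, 6, 7], [3, 8, 12], [4, 5, 6], [4, 7, 11], [5, 7, 9], [5, 11, 12], [6,
     8, 9], [8, 10, 11], [9, 10, 12]]"
    by code_simp
  from hole_decomposable_valid_design[OF this] show ?thesis by simp
qed

lemma hole_decomposable_13_4: "hole_decomposable 13 4"
proof -
  have "valid_design 13 4
    [[3, 0, 6, 5, 12], [1, 2, 11, 9, 12], [0, 4, 7], [0, 8, 9], [0, 10, 11], [1, 4, 10], [1,
     5, 8], [1, 6, 7], [2, 4, 5], [2, 6, 10], [2, 7, 8], [3, 4, 11], [3, 7, 9], [3, 8, 10],
     [4, 6, 9], [4, 8, 12], [5, 7, 11], [5, 9, 10], [6, 8, 11], [7, 10, 12]]"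
    by code_simp
  from hole_decomposable_valid_design[OF this] show ?thesis by simp
qed

lemma hole_decomposable_15_3: "hole_decomposable 15 3"
proof -
  have "valid_design 15 3
    [[0, 3, 11], [0, 4, 8], [0, 5, 13], [0, 6, 9], [0, 7, 10], [0, 12, 14], [1, 3, 8], [1,
     4, 9], [1, 5, 10], [1, 6, 7], [1, 11, 12], [1, 13, 14], [2, 3, 9], [2, 4, 5], [2, 6,
     14], [2, 7, 11], [2, 8, 10], [2, 12, 13], [3, 4, 6], [3, 5, 12], [3, 7, 14], [3, 10,
     13], [4, 7, 12], [4, 10, 14], [4, 11, 13], [5, 6, 11], [5, 7, 8], [5, 9, 14], [6, 8,
     13], [6, 10, 12], [7, 9, 13], [8, 9, 12], [8, 11, 14], [9, 10, 11]]"
    by code_simp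
  from hole_decomposable_valid_design[OF this] show ?thesis by simp
qed

lemma hole_decomposable_15_4: "hole_decomposable 15 4"
proof -
  have "valid_design 15 4
    [[1, 2, 6, 9, 11], [3, 0, 10, 9, 4], [0, 5, 11], [0, 6, 13], [0, 7, 8], [0, 12, 14], [1,
     4, 12], [1, 5, 10], [1, 7, 13], [1, 8, 14], [2, 4, 14], [2, 5, 7], [2, 8, 10], [2, 12,
     13], [3, 5, 12], [3, 6, 7], [3, 8, 13], [3, 11, 14], [4, 5, 13], [4, 6, 8], [4, 7, 11],
     [5, 6, 14], [5, 8, 9], [6, 10, 12], [7, 9, 12], [7, 10, 14], [8, 11, 12], [9, 13, 14],
     [10, 11, 13]]"
    by code_simp
  from hole_decomposable_valid_design[OF this] show ?thesis by simp
qed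

lemma hole_decomposable_16_3: "hole_decomposable 16 3"
proof -
  have "valid_design 16 3
    [[0, 5, 14, 4, 9], [3, 6, 15, 0, 7], [4, 1, 13, 3, 8], [7, 12, 10, 4, 1], [8, 10, 11, 0,
     5], [9, 11, 12, 3, 6], [13, 2, 15, 10, 9], [14, 2, 13, 11, 7], [15, 2, 14, 12, 8], [0,
     12, 13], [3, 5, 2], [3, 10, 14], [4, 6, 2], [4, 11, 15], [1, 5, 15], [1, 6, 14], [1, 9,
     11], [5, 6, 13], [5, 7, 12], [6, 8, 10], [7, 8, 9]]"
    by code_simp
  from hole_decomposable_valid_design[OF this] show ?thesis by simp
qed

lemma hole_decomposable_16_4: "hole_decomposable 16 4"
proof -
  have "valid_design 16 4
    [[7, 6, 0, 15, 12], [12, 5, 8, 11, 3], [13, 11, 14, 7, 1], [14, 15, 9, 10, 8], [10, 4,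
     5, 7, 6], [9, 8, 4, 13, 0], [0, 5, 14], [0, 10, 11], [1, 4, 15], [1, 5, 9], [1, 6, 8],
     [1, 10, 12], [2, 4, 11], [2, 5, 15], [2, 6, 14], [2, 7, 8], [2, 9, 12], [2, 10, 13],
     [3, 4, 10], [3, 6, 13], [3, 7, 9], [3, 14, 15], [4, 12, 14], [5, 12, 13], [6, 9, 11],
     [11, 13, 15]]"
    by code_simp
  from hole_decomposable_valid_design[OF this] show ?thesis by simp
qed

lemma hole_decomposable_18_3: "hole_decomposable 18 3"
proof -
  have "valid_design 18 3
    [[5, 14, 10, 12, 3], [8, 7, 9, 11, 13], [6, 11, 12, 2, 15], [0, 17, 9, 6, 5], [12, 3, 1,
     17, 13], [10, 13, 6, 16, 4], [16, 9, 1, 14, 15], [2, 4, 14, 17, 7], [1, 15, 8, 5, 4],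
     [0, 3, 8], [0, 4, 11], [0, 7, 10], [0, 12, 16], [0, 13, 14], [0, 15, 17], [1, 6, 7],
     [1, 10, 11], [2, 3, 4], [2, 5, 13], [2, 8, 16], [2, 9, 10], [3, 6, 11], [3, 7, 15], [3,
     9, 16], [4, 9, 12], [5, 7, 16], [5, 11, 14], [6, 8, 14], [7, 8, 12], [8, 10, 17], [10,
     13, 15], [11, 16, 17]]"
    by code_simp
  from hole_decomposable_valid_design[OF this] show ?thesis by simp
qed

lemma hole_decomposable_18_4: "hole_decomposable 18 4"
proof -
  have "valid_design 18 4
    [[9, 4, 13, 11, 3], [13, 11, 6, 16, 10], [5, 17, 2, 10, 4], [7, 14, 5, 11, 15], [12, 10,
     7, 8, 1], [16, 15, 9, 2, 8], [6, 8, 14, 3, 17], [0, 4, 7], [0, 5, 16], [0, 6, 9], [0,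
     8, 11], [0, 10, 14], [0, 12, 13], [0, 15, 17], [1, 4, 9], [1, 5, 6], [1, 11, 17], [1,
     13, 15], [1, 14, 16], [2, 6, 7], [2, 11, 12], [2, 13, 14], [3, 5, 12], [3, 7, 16], [3,
     10, 15], [4, 6, 8], [4, 12, 14], [4, 15, 16], [5, 8, 13], [5, 9, 17], [6, 12, 15], [7,
     9, 14], [7, 13, 17], [9, 10, 12], [12, 16, 17]]"
    by code_simp
  from hole_decomposable_valid_design[OF this] show ?thesis by simp
qed

text \<open>A hole of 9 points can be filled by the designs of order 9 with hole 3 or hole 4, so a
  single design with hole 9 yields both smaller holes.\<close>

lemma hole_decomposable_19_9: "hole_decomposable 19 9"
proof -
  have "valid_design 19 9
    [[0, 9, 14], [0, 10, 17], [0, 11, 16], [0, 12, 18], [0, 13, 15], [1, 9, 12], [1, 10,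
     16], [1, 11, 14], [1, 13, 17], [1, 15, 18], [2, 9, 11], [2, 10, 15], [2, 12, 13], [2,
     14, 17], [2, 16, 18], [3, 9, 18], [3, 10, 14], [3, 11, 13], [3, 12, 17], [3, 15, 16],
     [4, 9, 10], [4, 11, 17], [4, 12, 16], [4, 13, 18], [4, 14, 15], [5, 9, 13], [5, 10,
     11], [5, 12, 15], [5, 14, 16], [5, 17, 18], [6, 9, 16], [6, 10, 13], [6, 11, 18], [6,
     12, 14], [6, 15, 17], [7, 9, 15], [7, 10, 18], [7, 11, 12], [7, 13, 14], [7, 16, 17],
     [8, 9, 17], [8, 10, 12], [8, 11, 15], [8, 13, 16], [8, 14, 18]]"
    by code_simp
  from hole_decomposable_valid_design[OF this] show ?thesis by simp
qed

lemma hole_decomposable_21_9: "hole_decomposable 21 9"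
proof -
  have "valid_design 21 9
    [[0, 9, 19], [0, 10, 17], [0, 11, 14], [0, 12, 16], [0, 13, 15], [0, 18, 20], [1, 9,
     14], [1, 10, 16], [1, 11, 19], [1, 12, 20], [1, 13, 17], [1, 15, 18], [2, 9, 20], [2,
     10, 15], [2, 11, 17], [2, 12, 19], [2, 13, 14], [2, 16, 18], [3, 9, 15], [3, 10, 11],
     [3, 12, 13], [3, 14, 16], [3, 17, 18], [3, 19, 20], [4, 9, 13], [4, 10, 20], [4, 11,
     15], [4, 12, 18], [4, 14, 17], [4, 16, 19], [5, 9, 12], [5, 10, 19], [5, 11, 13], [5,
     14, 18], [5, 15, 20], [5, 16, 17], [6, 9, 16], [6, 10, 13], [6, 11, 12], [6, 14, 15],
     [6, 17, 20], [6, 18, 19], [7, 9, 17], [7, 10, 18], [7, 11, 16], [7, 12, 15], [7, 13,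
     19], [7, 14, 20], [8, 9, 10], [8, 11, 20], [8, 12, 17], [8, 13, 18], [8, 14, 19], [8,
     15, 16], [9, 11, 18], [10, 12, 14], [13, 16, 20], [15, 17, 19]]"
    by code_simp
  from hole_decomposable_valid_design[OF this] show ?thesis by simp
qed

lemma hole_decomposable_22_3: "hole_decomposable 22 3"
proof -
  have "valid_design 22 3
    [[16, 13, 8, 3, 21], [15, 14, 17, 8, 11], [7, 17, 18, 6, 20], [18, 19, 5, 16, 9], [1, 0,
     4, 12, 6], [2, 12, 16, 17, 7], [21, 8, 5, 6, 10], [3, 5, 7, 0, 14], [10, 4, 11, 7, 19],
     [9, 11, 21, 12, 20], [20, 6, 13, 2, 14], [0, 8, 18], [0, 9, 15], [0, 10, 20], [0, 11,
     16], [0, 13, 19], [0, 17, 21], [1, 3, 9], [1, 5, 11], [1, 7, 8], [1, 10, 13], [1, 14,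
     15], [1, 16, 20], [1, 17, 19], [1, 18, 21], [2, 3, 11], [2, 4, 21], [2, 5, 12], [2, 8,
     9], [2, 10, 15], [2, 18, 19], [3, 4, 17], [3, 5, 20], [3, 6, 19], [3, 10, 12], [3, 15,
     18], [4, 5, 15], [4, 8, 20], [4, 9, 14], [4, 10, 18], [4, 13, 16], [5, 13, 17], [6, 9,
     11], [6, 15, 16], [7, 9, 13], [7, 15, 21], [8, 12, 19], [9, 10, 17], [10, 14, 16], [11,
     13, 18], [12, 13, 15], [12, 14, 18], [14, 19, 21], [15, 19, 20]]"
    by code_simp
  from hole_decomposable_valid_design[OF this] show ?thesis by simp
qed

lemma hole_decomposable_22_4: "hole_decomposable 22 4"
proof -
  have "valid_design 22 4
    [[20, 8, 9, 5, 12], [19, 15, 0, 13, 14], [10, 11, 9, 7, 13], [18, 13, 6, 2, 17], [17,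
     16, 20, 10, 19], [14, 12, 6, 21, 11], [9, 6, 4, 16, 0], [7, 21, 3, 18, 19], [4, 5, 15,
     21, 10], [0, 5, 11], [0, 7, 20], [0, 8, 18], [0, 10, 12], [0, 17, 21], [1, 4, 7], [1,
     5, 13], [1, 6, 10], [1, 8, 14], [1, 9, 21], [1, 11, 20], [1, 12, 19], [1, 15, 17], [1,
     16, 18], [2, 4, 20], [2, 5, 19], [2, 7, 21], [2, 8, 10], [2, 9, 14], [2, 11, 16], [2,
     12, 15], [3, 4, 12], [3, 5, 6], [3, 8, 16], [3, 9, 17], [3, 10, 14], [3, 11, 15], [3,
     13, 20], [4, 5, 18], [4, 8, 13], [4, 11, 19], [4, 14, 17], [5, 7, 14], [5, 16, 17], [6,
     7, 8], [6, 9, 19], [6, 15, 20], [7, 12, 17], [7, 15, 16], [8, 11, 17], [8, 15, 19], [8,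
     20, 21], [9, 15, 18], [10, 11, 18], [12, 13, 18], [12, 14, 16], [13, 16, 21], [14, 18,
     20]]"
    by code_simp
  from hole_decomposable_valid_design[OF this] show ?thesis by simp
qed

lemma hole_decomposable_24_3: "hole_decomposable 24 3"
proof -
  have "valid_design 24 3
    [[12, 8, 11, 5, 23], [20, 0, 19, 5, 3], [19, 9, 17, 7, 18], [11, 3, 6, 13, 16], [23, 1,
     18, 13, 22], [15, 17, 10, 12, 13], [4, 22, 9, 15, 20], [5, 10, 21, 16, 22], [14, 7, 3,
     1, 11], [2, 13, 21, 9, 19], [6, 18, 15, 5, 2], [21, 16, 15, 23, 1], [0, 4, 13], [0, 6,
     22], [0, 7, 16], [0, 8, 15], [0, 9, 11], [0, 10, 20], [0, 12, 21], [0, 14, 18], [0, 17,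
     23], [1, 4, 10], [1, 5, 9], [1, 6, 19], [1, 8, 12], [1, 17, 20], [2, 3, 22], [2, 4,
     23], [2, 7, 13], [2, 8, 14], [2, 10, 11], [2, 12, 20], [2, 16, 17], [3, 4, 12], [3, 8,
     10], [3, 9, 23], [3, 15, 17], [3, 18, 21], [4, 5, 17], [4, 6, 7], [4, 8, 18], [4, 11,
     22], [4, 14, 21], [4, 16, 19], [5, 7, 10], [5, 13, 14], [6, 8, 17], [6, 9, 12], [6, 10,
     18], [6, 14, 23], [6, 20, 21], [7, 8, 21], [7, 12, 22], [7, 14, 15], [7, 20, 23], [8,
     9, 16], [8, 13, 20], [8, 19, 22], [9, 10, 14], [10, 19, 23], [11, 15, 19], [11, 17,
     21], [11, 18, 20], [12, 14, 19], [12, 16, 18], [14, 16, 20], [14, 17, 22]]"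
    by code_simp
  from hole_decomposable_valid_design[OF this] show ?thesis by simp
qed

lemma hole_decomposable_24_4: "hole_decomposable 24 4"
proof -
  have "valid_design 24 4
    [[21, 10, 18, 0, 9], [5, 22, 2, 13, 9], [16, 6, 22, 11, 15], [12, 8, 1, 23, 9], [23, 9,
     3, 16, 17], [13, 7, 15, 8, 14], [17, 18, 7, 13, 19], [14, 11, 20, 3, 21], [19, 20, 6,
     23, 4], [4, 15, 12, 21, 17], [0, 4, 15], [0, 5, 8], [0, 6, 13], [0, 7, 22], [0, 11,
     17], [0, 12, 19], [0, 14, 23], [0, 16, 20], [1, 4, 13], [1, 5, 7], [1, 6, 17], [1, 10,
     11], [1, 14, 16], [1, 15, 18], [1, 19, 20], [1, 21, 22], [2, 4, 8], [2, 6, 18], [2, 7,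
     11], [2, 10, 21], [2, 12, 14], [2, 15, 23], [2, 16, 19], [2, 17, 20], [3, 4, 22], [3,
     5, 15], [3, 6, 7], [3, 8, 19], [3, 10, 13], [3, 12, 18], [4, 5, 11], [4, 7, 9], [4, 10,
     14], [4, 16, 18], [5, 6, 16], [5, 10, 23], [5, 12, 22], [5, 14, 17], [5, 18, 20], [5,
     19, 21], [6, 8, 21], [6, 9, 14], [6, 10, 12], [7, 10, 20], [7, 12, 16], [7, 21, 23],
     [8, 10, 16], [8, 11, 12], [8, 17, 18], [8, 20, 22], [9, 11, 19], [9, 15, 20], [10, 15,
     19], [10, 17, 22], [11, 13, 23], [11, 14, 18], [12, 13, 20], [13, 16, 21], [14, 19,
     22], [18, 22, 23]]"
    by code_simp
  from hole_decomposable_valid_design[OF this] show ?thesis by simp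
qed

lemma hole_decomposable_28_9: "hole_decomposable 28 9"
proof -
  have "valid_design 28 9
    [[5, 0, 9, 12, 24], [13, 7, 20, 10, 24], [14, 15, 5, 20, 22], [2, 20, 19, 21, 11], [19,
     24, 15, 23, 14], [3, 11, 18, 9, 17], [10, 27, 12, 15, 21], [25, 4, 17, 23, 16], [21,
     17, 14, 13, 1], [16, 26, 22, 27, 1], [8, 1, 25, 20, 12], [23, 9, 20, 26, 2], [6, 18,
     27, 19, 24], [12, 22, 11, 3, 13], [0, 10, 17], [0, 11, 16], [0, 13, 27], [0, 14, 26],
     [0, 15, 25], [0, 18, 20], [0, 19, 22], [0, 21, 23], [1, 9, 19], [1, 10, 23], [1, 11,
     24], [1, 15, 18], [2, 10, 27], [2, 12, 14], [2, 13, 16], [2, 15, 17], [2, 18, 22], [2,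
     24, 25], [3, 10, 14], [3, 15, 26], [3, 16, 20], [3, 19, 25], [3, 21, 24], [3, 23, 27],
     [4, 9, 13], [4, 10, 19], [4, 11, 15], [4, 12, 18], [4, 14, 25], [4, 20, 27], [4, 21,
     26], [4, 22, 24], [5, 10, 11], [5, 13, 26], [5, 16, 19], [5, 17, 21], [5, 18, 23], [5,
     25, 27], [6, 9, 25], [6, 10, 26], [6, 11, 14], [6, 12, 22], [6, 13, 23], [6, 15, 16],
     [6, 17, 20], [6, 18, 21], [7, 9, 15], [7, 11, 27], [7, 12, 23], [7, 13, 19], [7, 14,
     16], [7, 17, 22], [7, 18, 26], [7, 21, 25], [8, 9, 10], [8, 11, 23], [8, 13, 15], [8,
     14, 18], [8, 16, 24], [8, 17, 27], [8, 19, 26], [8, 21, 22], [9, 14, 27], [9, 16, 21],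
     [9, 22, 23], [10, 16, 18], [10, 22, 25], [11, 25, 26], [12, 16, 26], [12, 17, 19], [13,
     18, 25], [17, 24, 26]]"
    by code_simp
  from hole_decomposable_valid_design[OF this] show ?thesis by simp
qed

lemma hole_decomposable_30_9: "hole_decomposable 30 9"
proof -
  have "valid_design 30 9
    [[28, 2, 11, 25, 10], [12, 7, 25, 23, 29], [1, 17, 14, 11, 27], [21, 11, 18, 19, 9],
     [10, 6, 27, 26, 21], [20, 19, 25, 26, 8], [18, 16, 24, 13, 27], [29, 5, 22, 13, 21],
     [13, 15, 3, 12, 19], [9, 14, 10, 16, 6], [23, 27, 20, 9, 0], [25, 22, 9, 4, 14], [26,
     0, 17, 12, 18], [4, 3, 17, 23, 21], [8, 24, 10, 15, 17], [0, 10, 13], [0, 11, 15], [0,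
     14, 29], [0, 16, 19], [0, 21, 25], [0, 22, 24], [0, 26, 28], [1, 9, 26], [1, 10, 29],
     [1, 12, 24], [1, 13, 28], [1, 15, 22], [1, 16, 21], [1, 17, 20], [1, 18, 25], [1, 19,
     23], [2, 9, 17], [2, 12, 27], [2, 13, 14], [2, 15, 18], [2, 16, 23], [2, 19, 24], [2,
     20, 22], [2, 21, 28], [2, 26, 29], [3, 9, 24], [3, 10, 18], [3, 11, 29], [3, 14, 26],
     [3, 16, 25], [3, 20, 28], [3, 22, 27], [4, 10, 12], [4, 11, 26], [4, 13, 20], [4, 15,
     27], [4, 16, 18], [4, 19, 28], [4, 24, 29], [5, 9, 29], [5, 10, 23], [5, 11, 12], [5,
     14, 19], [5, 15, 26], [5, 16, 17], [5, 18, 28], [5, 20, 24], [5, 25, 27], [6, 11, 13],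
     [6, 12, 22], [6, 15, 29], [6, 17, 28], [6, 18, 23], [6, 19, 20], [6, 24, 25], [7, 9,
     12], [7, 10, 20], [7, 11, 16], [7, 13, 17], [7, 14, 28], [7, 15, 21], [7, 18, 22], [7,
     19, 27], [7, 24, 26], [8, 9, 13], [8, 11, 24], [8, 12, 21], [8, 14, 18], [8, 16, 29],
     [8, 22, 28], [8, 23, 27], [9, 15, 28], [10, 19, 22], [11, 20, 21], [11, 22, 23], [12,
     14, 20], [12, 16, 28], [13, 15, 25], [13, 23, 26], [14, 15, 23], [14, 21, 24], [15, 16,
     20], [16, 22, 26], [17, 19, 29], [17, 22, 25], [18, 20, 29], [23, 24, 28], [27, 28, 29]]"
    by code_simp
  from hole_decomposable_valid_design[OF this] show ?thesis by simp
qed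

lemma hole_decomposable_34_9: "hole_decomposable 34 9"
proof -
  have "valid_design 34 9
    [[27, 2, 17, 20, 21], [5, 16, 9, 22, 19], [18, 6, 24, 14, 16], [1, 0, 18, 32, 26], [4,
     30, 12, 29, 25], [10, 25, 15, 13, 8], [23, 32, 11, 4, 28], [12, 7, 13, 16, 31], [17,
     24, 32, 29, 15], [21, 9, 4, 33, 31], [31, 3, 20, 10, 22], [11, 28, 19, 13, 18], [19,
     14, 8, 23, 12], [33, 20, 8, 30, 11], [15, 13, 5, 26, 27], [29, 8, 26, 21, 22], [22, 26,
     14, 11, 2], [0, 9, 30], [0, 10, 16], [0, 11, 12], [0, 13, 22], [0, 14, 33], [0, 15,
     31], [0, 17, 23], [0, 19, 24], [0, 20, 29], [0, 21, 25], [0, 27, 28], [1, 9, 20], [1,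
     10, 27], [1, 11, 31], [1, 12, 15], [1, 13, 24], [1, 14, 28], [1, 16, 21], [1, 17, 22],
     [1, 19, 30], [1, 23, 25], [1, 29, 33], [2, 9, 10], [2, 12, 32], [2, 13, 33], [2, 15,
     30], [2, 16, 28], [2, 18, 31], [2, 19, 29], [2, 23, 24], [2, 25, 27], [3, 9, 18], [3,
     11, 24], [3, 12, 17], [3, 13, 21], [3, 14, 15], [3, 16, 29], [3, 19, 31], [3, 23, 26],
     [3, 25, 33], [3, 27, 32], [3, 28, 30], [4, 10, 30], [4, 13, 14], [4, 15, 16], [4, 17,
     24], [4, 18, 22], [4, 19, 27], [4, 20, 26], [5, 10, 17], [5, 11, 25], [5, 12, 21], [5,
     14, 30], [5, 16, 33], [5, 18, 23], [5, 20, 32], [5, 24, 31], [5, 28, 29], [6, 9, 17],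
     [6, 10, 32], [6, 11, 27], [6, 12, 22], [6, 13, 20], [6, 15, 28], [6, 18, 30], [6, 19,
     21], [6, 23, 29], [6, 25, 31], [6, 26, 33], [7, 9, 32], [7, 10, 24], [7, 11, 21], [7,
     12, 28], [7, 14, 20], [7, 15, 23], [7, 17, 33], [7, 18, 29], [7, 19, 25], [7, 22, 27],
     [7, 26, 30], [8, 9, 28], [8, 16, 32], [8, 17, 18], [8, 24, 27], [8, 29, 31], [9, 11,
     15], [9, 12, 27], [9, 13, 29], [9, 14, 25], [9, 21, 23], [9, 24, 26], [10, 11, 29],
     [10, 12, 26], [10, 14, 19], [10, 18, 25], [10, 21, 28], [10, 23, 33], [11, 16, 17],
     [12, 18, 20], [12, 24, 33], [13, 17, 30], [13, 23, 32], [14, 17, 31], [14, 21, 32],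
     [14, 27, 29], [15, 18, 21], [15, 19, 20], [15, 22, 33], [16, 20, 23], [16, 25, 26],
     [16, 27, 30], [17, 19, 26], [17, 25, 28], [18, 27, 33], [19, 32, 33], [20, 24, 25],
     [20, 28, 33], [21, 24, 30], [22, 23, 30], [22, 24, 28], [22, 25, 32], [23, 27, 31],
     [26, 28, 31], [30, 31, 32]]"
    by code_simp
  from hole_decomposable_valid_design[OF this] show ?thesis by simp
qed

lemma hole_decomposable_36_9: "hole_decomposable 36 9"
proof -
  have "valid_design 36 9
    [[19, 33, 14, 31, 20], [7, 3, 29, 32, 18], [18, 14, 5, 9, 28], [35, 15, 30, 26, 18],
     [16, 25, 12, 9, 4], [23, 21, 15, 34, 8], [28, 12, 15, 0, 10], [1, 5, 22, 25, 29], [6,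
     30, 11, 32, 22], [8, 0, 25, 32, 13], [20, 9, 23, 27, 10], [26, 22, 13, 17, 12], [17,
     29, 35, 23, 11], [34, 32, 20, 24, 16], [27, 13, 24, 21, 4], [4, 11, 26, 28, 19], [24,
     10, 35, 31, 1], [2, 31, 9, 32, 26], [0, 9, 34], [0, 11, 31], [0, 14, 17], [0, 16, 35],
     [0, 18, 20], [0, 19, 27], [0, 21, 22], [0, 23, 30], [0, 24, 29], [0, 26, 33], [1, 9,
     30], [1, 11, 27], [1, 12, 18], [1, 13, 34], [1, 14, 16], [1, 15, 20], [1, 17, 28], [1,
     19, 33], [1, 21, 32], [1, 23, 26], [2, 10, 16], [2, 11, 34], [2, 12, 23], [2, 13, 33],
     [2, 14, 15], [2, 17, 30], [2, 18, 24], [2, 19, 29], [2, 20, 25], [2, 21, 31], [2, 22,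
     27], [2, 28, 35], [3, 9, 19], [3, 10, 11], [3, 12, 14], [3, 13, 27], [3, 15, 31], [3,
     16, 33], [3, 17, 34], [3, 20, 28], [3, 21, 35], [3, 22, 23], [3, 24, 30], [3, 25, 26],
     [4, 10, 29], [4, 11, 15], [4, 14, 18], [4, 17, 32], [4, 20, 35], [4, 22, 34], [4, 23,
     31], [4, 30, 33], [5, 10, 17], [5, 11, 20], [5, 12, 19], [5, 13, 15], [5, 16, 31], [5,
     21, 26], [5, 23, 32], [5, 24, 33], [5, 27, 35], [5, 30, 34], [6, 9, 29], [6, 10, 26],
     [6, 12, 24], [6, 13, 31], [6, 14, 30], [6, 15, 16], [6, 17, 20], [6, 18, 27], [6, 19,
     21], [6, 23, 33], [6, 25, 35], [6, 28, 34], [7, 9, 11], [7, 10, 34], [7, 12, 20], [7,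
     13, 28], [7, 14, 27], [7, 15, 35], [7, 16, 26], [7, 17, 31], [7, 19, 22], [7, 21, 33],
     [7, 23, 24], [7, 25, 30], [8, 9, 33], [8, 10, 30], [8, 11, 18], [8, 12, 35], [8, 14,
     26], [8, 16, 29], [8, 17, 19], [8, 20, 22], [8, 24, 28], [8, 27, 31], [9, 13, 35], [9,
     15, 22], [9, 17, 24], [9, 20, 21], [10, 13, 19], [10, 14, 32], [10, 18, 21], [10, 22,
     33], [10, 24, 25], [11, 12, 21], [11, 13, 16], [11, 14, 24], [11, 25, 33], [12, 27,
     33], [12, 28, 29], [12, 30, 31], [12, 32, 34], [13, 14, 29], [13, 18, 23], [13, 20,
     30], [14, 21, 23], [14, 22, 35], [14, 25, 34], [15, 17, 25], [15, 19, 24], [15, 27,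
     32], [15, 29, 33], [16, 17, 27], [16, 18, 22], [16, 19, 30], [16, 21, 25], [16, 23,
     28], [17, 18, 33], [17, 21, 29], [18, 19, 34], [18, 25, 31], [19, 23, 25], [19, 32,
     35], [20, 26, 29], [21, 28, 30], [22, 24, 26], [22, 28, 31], [25, 27, 28], [26, 27,
     34], [27, 29, 30], [28, 32, 33], [29, 31, 34], [33, 34, 35]]"
    by code_simp
  from hole_decomposable_valid_design[OF this] show ?thesis by simp
qed

section \<open>Filling holes, and the induction on the order\<close>

lemma hole_decomposable_trans:
  assumes "hole_decomposable n m" "hole_decomposable m h" "h \<le> m" "m \<le> n"
  shows "hole_decomposable n h"
  unfolding hole_decomposable_def
proof (intro allI impI, elim conjE)
  fix V H :: "nat set"
  assume V: "finite V" "card V = n" "H \<subseteq> V" "card H = h"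
  then obtain U where U: "H \<subseteq> U" "U \<subseteq> V" "card U = m"
    using exists_subset_between[of H m V] assms(3,4) by metis
  have "finite U" using V U finite_subset by blast
  then have "decomposable ((pairs V - pairs U) \<union> (pairs U - pairs H))"
    using U V by (intro decomposable_Un hole_decomposableD[OF assms(1)] hole_decomposableD[OF assms(2)]) auto
  moreover have "(pairs V - pairs U) \<union> (pairs U - pairs H) = pairs V - pairs H"
    using U by (auto simp: pairs_def)
  ultimately show "decomposable (pairs V - pairs H)" by simp
qed

text \<open>A hole of at most one point contains no edge, and a hole of three points is a single
  triangle.\<close>

lemma hole_decomposable_0:
  assumes "hole_decomposable n h" "h \<in> {0, 1, 3}" "h \<le> n"
  shows "hole_decomposable n 0"
proof -
  have small: "decomposable (pairs W)" if W: "card W \<in> {0, 1, 3}" "finite W" for W :: "nat set"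
  proof -
    consider "W = {}" | a where "W = {a}" | a b c where "W = {a, b, c}" "distinct [a, b, c]"
      using W by (auto simp: card_1_singleton_iff card_3_iff)
    then show ?thesis
    proof cases
      case 3
      then have "pairs W = arcs (cell_edges [a, b, c])" by (auto simp: pairs_def arcs_def)
      then show ?thesis using decomposable_cell[OF 3(2)] by simp
    next
      case 2
      then have "pairs W = {}" by (auto simp: pairs_def)
      then show ?thesis by (simp add: decomposable_empty)
    qed (simp add: pairs_def decomposable_empty)
  qed
  then have "hole_decomposable h 0"
    unfolding hole_decomposable_def
  proof (intro allI impI, elim conjE)
    fix V W :: "nat set"
    assume V: "finite V" "card V = h" "W \<subseteq> V" "card W = 0"
    then have "W = {}" using finite_subset card_0_eq by blast
    then have "pairs W = {}" by (simp add: pairs_def)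
    moreover have "card V \<in> {0, 1, 3}" using assms(2) V by simp
    ultimately show "decomposable (pairs V - pairs W)" using small[OF _ V(1)] by simp
  qed
  then show ?thesis using hole_decomposable_trans assms by blast
qed

lemma hole_decomposable_1:
  assumes "hole_decomposable n 0"
  shows "hole_decomposable n 1"
  unfolding hole_decomposable_def
proof (intro allI impI, elim conjE)
  fix V W :: "nat set"
  assume V: "finite V" "card V = n" "W \<subseteq> V" "card W = 1"
  then have "pairs V - pairs W = pairs V - pairs {}" by (auto simp: pairs_def card_1_singleton_iff)
  then show "decomposable (pairs V - pairs W)"
    using hole_decomposableD[OF assms V(1,2), of "{}"] by simp
qed

text \<open>Besides 9, the orders treated directly are those for which the tripled order v would be
  too small or missing: v = 6 for 16 and 18; v = 7 for 13, 15, 19 and 21; v = 10 for 22, 24, 28 and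
  30; v = 12 for 34 and 36.\<close>

lemma hole_decomposable_3_4:
  assumes "n mod 3 = 0 \<or> n mod 3 = 1" "n \<ge> 9" "even n \<longrightarrow> n \<ge> 16"
  shows "hole_decomposable n 3 \<and> hole_decomposable n 4"
  using assms
proof (induction n rule: less_induct)
  case (less n)
  show ?case
  proof (cases "n \<in> {9, 13, 15, 19, 21, 16, 18, 22, 24, 28, 30, 34, 36}")
    case True
    have "hole_decomposable m 3 \<and> hole_decomposable m 4" if "hole_decomposable m 9" "m \<ge> 9" for m
      using that hole_decomposable_trans[OF _ hole_decomposable_9_3] hole_decomposable_trans[OF _ hole_decomposable_9_4]
      by simp
    note 9 = this[OF hole_decomposable_19_9] this[OF hole_decomposable_21_9] this[OF hole_decomposable_28_9]
      this[OF hole_decomposable_30_9] this[OF hole_decomposable_34_9] this[OF hole_decomposable_36_9]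
    show ?thesis using True 9 hole_decomposable_9_3 hole_decomposable_9_4 hole_decomposable_13_3
        hole_decomposable_13_4 hole_decomposable_15_3 hole_decomposable_15_4 hole_decomposable_16_3
        hole_decomposable_16_4 hole_decomposable_18_3 hole_decomposable_18_4 hole_decomposable_22_3
        hole_decomposable_22_4 hole_decomposable_24_3 hole_decomposable_24_4
      by (elim insertE emptyE; simp)
  next
    case False
    have big: "n \<ge> 25" using less.prems False by (cases "n < 25") (simp, presburger, simp)
    \<comment> \<open>The least of 0, 1, 3, 4 for which 3 divides n + 2w with a quotient v that is 0
      or 1 modulo 3.\<close>
    define w where "w = (if n mod 9 \<in> {0, 3} then 0 else if n mod 9 \<in> {1, 7} then 1
      else if n mod 9 = 6 then 3 else (4 :: nat))"
    have n9: "n mod 9 \<in> {0, 1, 3, 4, 6, 7}" using less.prems(1) by (simp, presburger)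
    then have "n mod 9 + 2 * w \<in> {3 * 0, 3 * 1, 3 * 3, 3 * 4}" by (auto simp: w_def)
    then obtain c where c: "n mod 9 + 2 * w = 3 * c" "c \<in> {0, 1, 3, 4}" by blast
    obtain q r where qr: "n = 9 * q + r" "r = n mod 9" by (metis mult_div_mod_eq)
    define v where "v = 3 * q + c"
    have v: "n + 2 * w = 3 * v" using c(1) qr(1) unfolding v_def qr(2)[symmetric] by simp
    have v3: "v mod 3 = 0 \<or> v mod 3 = 1" using c(2) by (auto simp: v_def)
    have w: "w \<in> {0, 1, 3, 4}" by (simp add: w_def)
    have par: "even v \<longleftrightarrow> even n" using v by presburger
    have "v < n" using v w big by auto
    have "v \<ge> 9" using v big by auto
    \<comment> \<open>The only admissible even values from 9 to 15 are 10 and 12; every n tripled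
      from them is in the list above.\<close>
    have "v \<ge> 16" if "even v"
    proof (rule ccontr)
      assume "\<not> v \<ge> 16"
      then have "v = 10 \<or> v = 12" using \<open>v \<ge> 9\<close> that v3 by presburger
      then have "n = 30 - 2 * w \<or> n = 36 - 2 * w" using v by auto
      then show False using False w big by auto
    qed
    then have "even v \<longrightarrow> v \<ge> 16" by simp
    have IH: "hole_decomposable v 3 \<and> hole_decomposable v 4"
      using less.IH[OF \<open>v < n\<close> v3 \<open>v \<ge> 9\<close> \<open>even v \<longrightarrow> v \<ge> 16\<close>] .
    have v0: "hole_decomposable v 0" using hole_decomposable_0[of v 3] IH \<open>v \<ge> 9\<close> by simp
    have "hole_decomposable v w" using w IH v0 hole_decomposable_1[OF v0] by auto
    then show ?thesis
      using hole_decomposable_triple[OF _ _ _ _ v] IH w \<open>v \<ge> 9\<close> by auto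
  qed
qed

lemma decomposable_pairs:
  fixes V :: "nat set"
  assumes "finite V" "card V = n" "n > 0"
    and "n mod 3 = 0 \<or> n mod 3 = 1" "n \<notin> {4, 6, 10, 12}"
  shows "decomposable (pairs V)"
proof -
  have "n \<in> {1, 3, 7} \<or> n \<ge> 9 \<and> (even n \<longrightarrow> n \<ge> 16)"
    using assms by simp presburger
  \<comment> \<open>For orders 1 and 3 the hole is everything and no edge remains; the hole is then
    filled by \<open>hole_decomposable_0\<close>.\<close>
  moreover have "hole_decomposable 1 1" "hole_decomposable 3 3"
    unfolding hole_decomposable_def using card_subset_eq by (metis Diff_cancel decomposable_empty)+
  ultimately have "\<exists>h\<in>{0, 1, 3}. h \<le> n \<and> hole_decomposable n h"
    using hole_decomposable_3_4[OF assms(4)] hole_decomposable_7_3 by fastforce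
  then have "hole_decomposable n 0" using hole_decomposable_0 by blast
  from hole_decomposableD[OF this assms(1,2), of "{}"] show ?thesis by (simp add: pairs_def)
qed

section \<open>Blocks and the quasigroup operation\<close>

locale directed_blocks =
  fixes V :: "'a set" and B :: "'a ttriple set"
  assumes finite_V: "finite V"
    and blocks: "t \<in> B \<Longrightarrow> distinct_triple t \<and> points t \<subseteq> V"
    and ex1_block: "x \<in> V \<Longrightarrow> y \<in> V \<Longrightarrow> x \<noteq> y \<Longrightarrow> \<exists>!t. t \<in> B \<and> (x, y) \<in> ordered_pairs t"
begin

lemma distinct_block: "(x, y, z) \<in> B \<Longrightarrow> x \<noteq> y \<and> y \<noteq> z \<and> x \<noteq> z \<and> x \<in> V \<and> y \<in> V \<and> z \<in> V"
  using blocks[of "(x, y, z)"] by simp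

lemma unique_block:
  assumes "s \<in> B" "t \<in> B" "(x, y) \<in> ordered_pairs s" "(x, y) \<in> ordered_pairs t"
  shows "s = t"
proof -
  have "x \<in> V \<and> y \<in> V \<and> x \<noteq> y" using blocks[OF assms(1)] assms(3) by (cases s) auto
  then show ?thesis using ex1_block[of x y] assms by (metis (no_types))
qed

text \<open>The names here and below tell where the pair (a, b) sits in a block: in the first two,
  the last two or the outer two places. A pair occurs in one block and hence in one kind of
  place.\<close>

lemma unique_first: "(a, b, c) \<in> B \<Longrightarrow> (a, b, d) \<in> B \<Longrightarrow> c = d"
  and unique_last: "(c, a, b) \<in> B \<Longrightarrow> (d, a, b) \<in> B \<Longrightarrow> c = d"
  and unique_outer: "(a, c, b) \<in> B \<Longrightarrow> (a, d, b) \<in> B \<Longrightarrow> c = d"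
  using unique_block[of "(a, b, c)" "(a, b, d)" a b] unique_block[of "(c, a, b)" "(d, a, b)" a b]
    unique_block[of "(a, c, b)" "(a, d, b)" a b] by simp_all

lemma not_first_last: "(a, b, c) \<in> B \<Longrightarrow> (d, a, b) \<notin> B"
  and not_first_outer: "(a, b, c) \<in> B \<Longrightarrow> (a, d, b) \<notin> B"
  and not_last_outer: "(c, a, b) \<in> B \<Longrightarrow> (a, d, b) \<notin> B"
  using unique_block[of "(a, b, c)" "(d, a, b)" a b] unique_block[of "(a, b, c)" "(a, d, b)" a b]
    unique_block[of "(c, a, b)" "(a, d, b)" a b] distinct_block by fastforce+

lemma block_cases:
  assumes "x \<in> V" "y \<in> V" "x \<noteq> y"
  obtains z where "(x, y, z) \<in> B" | z where "(z, x, y) \<in> B" | z where "(x, z, y) \<in> B"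
proof -
  obtain t where t: "t \<in> B" "(x, y) \<in> ordered_pairs t" using ex1_block[OF assms] by (elim ex1E conjE)
  then show ?thesis using that by (cases t) auto
qed

lemma block_of_eq:
  assumes "t \<in> B" "(x, y) \<in> ordered_pairs t"
  shows "block_of B x y = t"
  unfolding block_of_def using assms unique_block by blast

lemma dts_op_block:
  assumes "(x, y, z) \<in> B"
  shows "dts_op B x y = z" "dts_op B y z = x" "dts_op B x z = y"
proof -
  have "block_of B x y = (x, y, z)" "block_of B y z = (x, y, z)" "block_of B x z = (x, y, z)"
    using block_of_eq[OF assms] by simp_all
  then show "dts_op B x y = z" "dts_op B y z = x" "dts_op B x z = y"
    using distinct_block[OF assms] by (auto simp: dts_op_def)
qed

lemma dts_op_same: "dts_op B x x = x"
  by (simp add: dts_op_def)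

lemma dts_op_cases:
  assumes "x \<in> V" "y \<in> V" "x \<noteq> y"
  obtains "(x, y, dts_op B x y) \<in> B" | "(dts_op B x y, x, y) \<in> B" | "(x, dts_op B x y, y) \<in> B"
  using block_cases[OF assms] dts_op_block by metis

lemma dts_op_props:
  assumes "x \<in> V" "y \<in> V" "x \<noteq> y"
  shows "dts_op B x y \<in> V" "dts_op B x y \<noteq> x" "dts_op B x y \<noteq> y"
  using dts_op_cases[OF assms] distinct_block by metis+

text \<open>For the first part a * y = x is solved for a. Two of the three possible orders of the
  block on a, y, x contain the pair (x, y), which already lies in (x, y, z). The second part treats
  y * b = z and the pair (y, z) likewise.\<close>

lemma quasigroup_middle:
  assumes q: "quasigroup_on V (dts_op B)" and xyz: "(x, y, z) \<in> B"
  shows "\<exists>w. (w, y, x) \<in> B" "\<exists>w. (z, y, w) \<in> B"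
proof -
  note d = distinct_block[OF xyz]
  obtain a where a: "a \<in> V" "dts_op B a y = x" using q d unfolding quasigroup_on_def by blast
  then have "a \<noteq> y" using d dts_op_same by metis
  then have "(a, y, x) \<in> B"
    using dts_op_cases[of a y] a d xyz not_first_outer not_first_last unique_first by metis
  then show "\<exists>w. (w, y, x) \<in> B" by blast
  obtain b where b: "b \<in> V" "dts_op B y b = z" using q d unfolding quasigroup_on_def by blast
  then have "y \<noteq> b" using d dts_op_same by metis
  then have "(z, y, b) \<in> B"
    using dts_op_cases[of y b] b d xyz not_first_last not_last_outer unique_last by metis
  then show "\<exists>w. (z, y, w) \<in> B" by blast
qed

lemma flexible_local:
  assumes q: "quasigroup_on V (dts_op B)"
    and flex: "\<forall>x\<in>V. \<forall>y\<in>V. dts_op B x (dts_op B y x) = dts_op B (dts_op B x y) x"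
    and xyz: "(x, y, z) \<in> B"
  shows "\<exists>u w. (w, y, x) \<in> B \<and> (x, u, w) \<in> B \<and> (z, u, x) \<in> B"
proof -
  note mid = quasigroup_middle[OF q]
  obtain w where w: "(w, y, x) \<in> B" using mid(1)[OF xyz] by blast
  note d = distinct_block[OF xyz] distinct_block[OF w]
  define u where "u = dts_op B x w"
  have u': "u = dts_op B z x"
    using flex d dts_op_block[OF xyz] dts_op_block[OF w] unfolding u_def by metis
  \<comment> \<open>By \<open>quasigroup_middle\<close>, every wrong position of u would give a
    block with (x, z) or (w, x) in adjacent places, whereas these are outer pairs of (x, y, z) and
    (w, y, x).\<close>
  have "(z, x, u) \<notin> B" using mid(1)[of z x u] xyz not_last_outer by blast
  moreover have "(u, x, w) \<notin> B"
    using mid(2)[of u x w] w not_first_outer by blast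
  ultimately have 1: "(u, x, w) \<notin> B" "(z, x, u) \<notin> B" by blast+
  have 2: "(x, w, u) \<notin> B" using mid(1)[of x w u] w not_last_outer by blast
  have 3: "(u, z, x) \<notin> B" using mid(2)[of u z x] xyz not_first_outer by blast
  have "(x, u, w) \<in> B" using dts_op_cases[of x w] d 1 2 unfolding u_def[symmetric] by blast
  moreover have "(z, u, x) \<in> B" using dts_op_cases[of z x] d 1 3 unfolding u'[symmetric] by blast
  ultimately show ?thesis using w by blast
qed

end

section \<open>From the local block condition back to the quasigroup\<close>

locale flexible_system = directed_blocks +
  assumes flexible_block: "(x, y, z) \<in> B \<Longrightarrow> \<exists>u w. (w, y, x) \<in> B \<and> (x, u, w) \<in> B \<and> (z, u, x) \<in> B"
begin

lemma block_before: "(x, y, z) \<in> B \<Longrightarrow> \<exists>w. (w, y, x) \<in> B"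
  using flexible_block by blast

text \<open>The condition is applied twice: to (x, y, z), giving (z, u, x), and to that block,
  giving a block on the outer pair (x, z), whose middle point must be y.\<close>

lemma block_after:
  assumes "(x, y, z) \<in> B"
  shows "\<exists>w. (z, y, w) \<in> B"
proof -
  obtain u where "(z, u, x) \<in> B" using flexible_block[OF assms] by blast
  then obtain u' w where "(w, u, z) \<in> B" "(z, u', w) \<in> B" "(x, u', z) \<in> B" using flexible_block by blast
  then show ?thesis using unique_outer[OF assms] by blast
qed

text \<open>If y is the middle point of the block containing (x, y), then it is also the middle
  point of the block containing (y, x), and similarly for z.\<close>

lemma no_middle_end: "(x, y, z) \<in> B \<Longrightarrow> (y, x, w) \<notin> B" "(x, y, z) \<in> B \<Longrightarrow> (y, w, x) \<notin> B"
  "(x, y, z) \<in> B \<Longrightarrow> (w, z, y) \<notin> B" "(x, y, z) \<in> B \<Longrightarrow> (z, w, y) \<notin> B"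
  using block_before block_after not_first_last not_first_outer not_last_outer by metis+

lemma dts_op_inj_right:
  assumes "a \<in> V" "x \<in> V" "x' \<in> V" "a \<noteq> x" "a \<noteq> x'" "dts_op B a x = dts_op B a x'"
  shows "x = x'"
  using dts_op_cases[of a x] dts_op_cases[of a x'] assms no_middle_end
    unique_first unique_last unique_outer not_first_last not_first_outer not_last_outer
  by metis

lemma dts_op_inj_left:
  assumes "a \<in> V" "x \<in> V" "x' \<in> V" "a \<noteq> x" "a \<noteq> x'" "dts_op B x a = dts_op B x' a"
  shows "x = x'"
  using dts_op_cases[of x a] dts_op_cases[of x' a] assms no_middle_end
    unique_first unique_last unique_outer not_first_last not_first_outer not_last_outer
  by metis

lemma quasigroup: "quasigroup_on V (dts_op B)"
proof -
  have cl: "dts_op B x y \<in> V" if "x \<in> V" "y \<in> V" for x y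
    using dts_op_props dts_op_same that by metis
  have bij: "\<exists>!x. x \<in> V \<and> f x = b" if "inj_on f V" "f ` V \<subseteq> V" "b \<in> V" for f b
  proof (rule ex_ex1I)
    show "\<exists>x. x \<in> V \<and> f x = b" using endo_inj_surj[OF finite_V that(2,1)] that(3) by (metis imageE)
    show "x = y" if "x \<in> V \<and> f x = b" "y \<in> V \<and> f y = b" for x y
      using \<open>inj_on f V\<close> that by (metis inj_onD)
  qed
  have "inj_on (dts_op B a) V" "inj_on (\<lambda>y. dts_op B y a) V" if "a \<in> V" for a
    unfolding inj_on_def using that dts_op_inj_left dts_op_inj_right dts_op_props dts_op_same by metis+
  then show ?thesis
    unfolding quasigroup_on_def using cl bij[of "dts_op B _"] bij[of "\<lambda>y. dts_op B y _"] by (simp add: image_subset_iff)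
qed

lemma flexible_law:
  assumes "x \<in> V" "y \<in> V"
  shows "dts_op B x (dts_op B y x) = dts_op B (dts_op B x y) x"
proof (cases "x = y")
  case False
  show ?thesis
  proof (cases rule: block_cases[OF assms False])
    case (1 z)
    then obtain u w where "(w, y, x) \<in> B" "(x, u, w) \<in> B" "(z, u, x) \<in> B" using flexible_block by blast
    with 1 show ?thesis by (metis dts_op_block)
  next
    case (2 z)
    then obtain b where "(y, x, b) \<in> B" using block_after by blast
    with 2 show ?thesis by (metis dts_op_block)
  next
    case (3 z)
    then obtain u w where "(w, z, x) \<in> B" "(x, u, w) \<in> B" "(y, u, x) \<in> B" using flexible_block by blast
    with 3 show ?thesis by (metis dts_op_block)
  qed
qed (simp add: dts_op_same)

end

section \<open>Equivalence of the local condition with flexible Latin directed triple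
  systems\<close>

lemma ordered_pairs_subset_pairs:
  "distinct_triple t \<Longrightarrow> ordered_pairs t \<subseteq> pairs V \<longleftrightarrow> points t \<subseteq> V"
  by (cases t) (auto simp: pairs_def)

lemma flexible_blocks_pairs_iff: "finite V \<and> flexible_blocks (pairs V) B \<longleftrightarrow> flexible_system V B"
proof
  assume *: "finite V \<and> flexible_blocks (pairs V) B"
  then have fb: "flexible_blocks (pairs V) B" ..
  show "flexible_system V B"
  proof
    show "distinct_triple t \<and> points t \<subseteq> V" if "t \<in> B" for t
      using flexible_blocksD(1,2)[OF fb that] ordered_pairs_subset_pairs by blast
    show "\<exists>!t. t \<in> B \<and> (x, y) \<in> ordered_pairs t" if "x \<in> V" "y \<in> V" "x \<noteq> y" for x y
      using that by (intro flexible_blocksD(3)[OF fb]) (simp add: pairs_def)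
    show "\<exists>u w. (w, y, x) \<in> B \<and> (x, u, w) \<in> B \<and> (z, u, x) \<in> B" if "(x, y, z) \<in> B" for x y z
      using flexible_blocksD(4)[OF fb that] .
  qed (use * in simp)
next
  assume "flexible_system V B"
  then interpret flexible_system V B .
  show "finite V \<and> flexible_blocks (pairs V) B"
    unfolding flexible_blocks_def
  proof (intro conjI ballI allI impI finite_V)
    fix t assume "t \<in> B"
    then show "distinct_triple t" "ordered_pairs t \<subseteq> pairs V"
      using blocks ordered_pairs_subset_pairs by blast+
  next
    fix e assume e: "e \<in> pairs V"
    obtain x y where xy: "e = (x, y)" by (cases e)
    show "\<exists>!t. t \<in> B \<and> e \<in> ordered_pairs t"
      unfolding xy by (rule ex1_block) (use e xy in \<open>auto simp: pairs_def\<close>)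
  qed (rule flexible_block)
qed

lemma flexible_ldts_iff: "flexible_ldts n V B \<longleftrightarrow> card V = n \<and> flexible_system V B"
proof
  assume f: "flexible_ldts n V B"
  interpret directed_blocks V B
    using f unfolding flexible_ldts_def latin_dts_def directed_triple_system_def by unfold_locales simp_all
  have "flexible_system V B"
    using f flexible_local unfolding flexible_ldts_def latin_dts_def by unfold_locales simp
  then show "card V = n \<and> flexible_system V B"
    using f unfolding flexible_ldts_def latin_dts_def directed_triple_system_def by simp
next
  assume *: "card V = n \<and> flexible_system V B"
  then interpret flexible_system V B by simp
  show "flexible_ldts n V B"
    unfolding flexible_ldts_def latin_dts_def directed_triple_system_def
    using * finite_V blocks ex1_block quasigroup flexible_law by simp
qed

section \<open>Counting the bipyramids with odd rim\<close>

text \<open>Here \<open>C i\<close> is the set of rim points of the bipyramid \<open>i\<close> and \<open>N i v\<close> the set of neighbours of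
  \<open>v\<close> in it.  The rim need not be a single cycle: only its 2-regularity is used.\<close>

locale odd_cells =
  fixes V :: "'a set" and I :: "'i set" and poles C :: "'i \<Rightarrow> 'a set" and N :: "'i \<Rightarrow> 'a \<Rightarrow> 'a set"
  assumes finite_V: "finite V" and finite_I: "finite I"
    and card_poles: "i \<in> I \<Longrightarrow> card (poles i) = 2"
    and poles_V: "i \<in> I \<Longrightarrow> poles i \<subseteq> V"
    and C_V: "i \<in> I \<Longrightarrow> C i \<subseteq> V"
    and poles_C: "i \<in> I \<Longrightarrow> poles i \<inter> C i = {}"
    and odd_C: "i \<in> I \<Longrightarrow> odd (card (C i))"
    and N_pole: "i \<in> I \<Longrightarrow> v \<in> poles i \<Longrightarrow> N i v = C i"
    and N_rim: "i \<in> I \<Longrightarrow> v \<in> C i \<Longrightarrow>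
      poles i \<subseteq> N i v \<and> N i v \<subseteq> poles i \<union> (C i - {v}) \<and> card (N i v) = 4"
    and N_other: "i \<in> I \<Longrightarrow> v \<notin> poles i \<Longrightarrow> v \<notin> C i \<Longrightarrow> N i v = {}"
    and N_sym: "i \<in> I \<Longrightarrow> w \<in> N i v \<Longrightarrow> v \<in> N i w"
    and N_disjoint: "i \<in> I \<Longrightarrow> j \<in> I \<Longrightarrow> i \<noteq> j \<Longrightarrow> N i v \<inter> N j v = {}"
    and odd_poles: "v \<in> V \<Longrightarrow> odd (card {i \<in> I. v \<in> poles i})"
begin

text \<open>Neighbours along the edges that belong to no odd bipyramid.\<close>

definition L :: "'a \<Rightarrow> 'a set" where
  "L v = V - {v} - (\<Union>i\<in>I. N i v)"

lemma finite_C: "i \<in> I \<Longrightarrow> finite (C i)" and finite_poles: "i \<in> I \<Longrightarrow> finite (poles i)"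
  using finite_subset[OF C_V finite_V] finite_subset[OF poles_V finite_V] by simp_all

lemma N_V: "i \<in> I \<Longrightarrow> N i v \<subseteq> V - {v}"
  using N_pole[of i v] N_rim[of i v] N_other[of i v] C_V[of i] poles_V[of i] poles_C[of i]
  by (cases "v \<in> poles i"; cases "v \<in> C i") auto

lemma finite_N: "i \<in> I \<Longrightarrow> finite (N i v)"
  using N_V finite_V finite_subset by blast

text \<open>A rim point has four neighbours, of which at most two are poles; so there are two
  further points on its rim.\<close>

lemma card_C_ge_3:
  assumes "i \<in> I"
  shows "3 \<le> card (C i)"
proof -
  obtain v where v: "v \<in> C i" using odd_C[OF assms] by fastforce
  have "4 \<le> card (poles i \<union> (C i - {v}))"
    using N_rim[OF assms v] finite_C[OF assms] finite_poles[OF assms] by (metis card_mono finite_Diff finite_UnI)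
  also have "\<dots> \<le> 2 + (card (C i) - 1)"
    using card_Un_le[of "poles i" "C i - {v}"] card_poles[OF assms] v by simp
  finally show ?thesis by simp
qed

lemma finite_L: "finite (L v)"
  using finite_V by (simp add: L_def)

lemma L_V: "L v \<subseteq> V - {v}"
  by (auto simp: L_def)

lemma L_sym: "v \<in> V \<Longrightarrow> w \<in> L v \<Longrightarrow> v \<in> L w"
  using N_sym unfolding L_def by blast

lemma sum_N:
  assumes "v \<in> V"
  shows "(\<Sum>i\<in>I. card (N i v)) = (\<Sum>i\<in>{i \<in> I. v \<in> poles i}. card (C i)) + 4 * card {i \<in> I. v \<in> C i}"
proof -
  have "card (N i v) = (if v \<in> poles i then card (C i) else 0) + (if v \<in> C i then 4 else 0)" if "i \<in> I" for i
    using N_pole[OF that, of v] N_rim[OF that, of v] N_other[OF that, of v] poles_C[OF that]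
    by (cases "v \<in> poles i"; cases "v \<in> C i") auto
  then have "(\<Sum>i\<in>I. card (N i v)) = (\<Sum>i\<in>I. if v \<in> poles i then card (C i) else 0)
      + (\<Sum>i\<in>I. if v \<in> C i then 4 else 0)"
    by (simp add: sum.distrib)
  then show ?thesis
    using finite_I by (simp add: sum.If_cases Collect_conj_eq mult.commute)
qed

text \<open>The degree of v in the complete graph: a bipyramid contributes its rim length at a pole
  and 4 at a rim point.\<close>

lemma card_L:
  assumes "v \<in> V"
  shows "card (L v) + (\<Sum>i\<in>{i \<in> I. v \<in> poles i}. card (C i)) + 4 * card {i \<in> I. v \<in> C i} = card V - 1"
proof -
  have "card (\<Union>i\<in>I. N i v) = (\<Sum>i\<in>I. card (N i v))"
    using finite_I finite_N N_disjoint by (intro card_UN_disjoint) auto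
  moreover have sub: "(\<Union>i\<in>I. N i v) \<subseteq> V - {v}" using N_V by (intro UN_least)
  moreover have "card (L v) = card (V - {v}) - card (\<Union>i\<in>I. N i v)"
    unfolding L_def using finite_I finite_N sub by (intro card_Diff_subset) auto
  moreover have "card (\<Union>i\<in>I. N i v) \<le> card (V - {v})"
    using finite_V sub by (intro card_mono) auto
  ultimately show ?thesis using sum_N[OF assms] assms by simp
qed

lemma sum_card_rel:
  assumes "finite A" "finite J"
  shows "(\<Sum>v\<in>A. card {i \<in> J. R i v}) = (\<Sum>i\<in>J. card {v \<in> A. R i v})"
proof -
  have "(\<Sum>v\<in>A. card {i \<in> J. R i v}) = (\<Sum>v\<in>A. \<Sum>i\<in>J. if R i v then 1 else 0)"
    using assms by (simp add: sum.If_cases Collect_conj_eq)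
  also have "\<dots> = (\<Sum>i\<in>J. \<Sum>v\<in>A. if R i v then 1 else 0)" by (rule sum.swap)
  finally show ?thesis using assms by (simp add: sum.If_cases Collect_conj_eq)
qed

lemma sum_card_poles: "(\<Sum>v\<in>V. card {i \<in> I. v \<in> poles i}) = 2 * card I"
proof -
  have "{v \<in> V. v \<in> poles i} = poles i" if "i \<in> I" for i using poles_V[OF that] by blast
  then show ?thesis
    using sum_card_rel[OF finite_V finite_I, of "\<lambda>i v. v \<in> poles i"] card_poles by simp
qed

lemma sum_card_rims: "(\<Sum>v\<in>V. card {i \<in> I. v \<in> C i}) = (\<Sum>i\<in>I. card (C i))"
proof -
  have "{v \<in> V. v \<in> C i} = C i" if "i \<in> I" for i using C_V[OF that] by blast
  then show ?thesis
    using sum_card_rel[OF finite_V finite_I, of "\<lambda>i v. v \<in> C i"] by simp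
qed

lemma sum_poles_card_C: "(\<Sum>v\<in>V. \<Sum>i\<in>{i \<in> I. v \<in> poles i}. card (C i)) = 2 * (\<Sum>i\<in>I. card (C i))"
proof -
  have "(\<Sum>v\<in>V. \<Sum>i\<in>{i \<in> I. v \<in> poles i}. card (C i)) = (\<Sum>i\<in>I. \<Sum>v\<in>{v \<in> V. v \<in> poles i}. card (C i))"
    using finite_V finite_I by (rule sum.swap_restrict)
  also have "\<dots> = (\<Sum>i\<in>I. 2 * card (C i))"
  proof (rule sum.cong)
    fix i assume "i \<in> I"
    moreover have "{v \<in> V. v \<in> poles i} = poles i" using poles_V[OF \<open>i \<in> I\<close>] by blast
    ultimately show "(\<Sum>v\<in>{v \<in> V. v \<in> poles i}. card (C i)) = 2 * card (C i)"
      using card_poles by simp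
  qed simp
  finally show ?thesis by (simp add: sum_distrib_left)
qed

text \<open>Twice the number of edges: a bipyramid with rim length k has 3k edges.\<close>

lemma sum_card_L: "(\<Sum>v\<in>V. card (L v)) + 6 * (\<Sum>i\<in>I. card (C i)) = card V * (card V - 1)"
proof -
  have "(\<Sum>v\<in>V. card (L v)) + (\<Sum>v\<in>V. \<Sum>i\<in>{i \<in> I. v \<in> poles i}. card (C i))
      + (\<Sum>v\<in>V. 4 * card {i \<in> I. v \<in> C i}) = (\<Sum>v\<in>V. card V - 1)"
    unfolding sum.distrib[symmetric] using card_L by (intro sum.cong) auto
  then show ?thesis
    using sum_poles_card_C sum_card_rims by (simp add: sum_distrib_left[symmetric])
qed

lemma card_V_le: "card V \<le> 2 * card I"
proof -
  have "(\<Sum>v\<in>V. 1) \<le> (\<Sum>v\<in>V. card {i \<in> I. v \<in> poles i})"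
    using odd_poles by (intro sum_mono) (metis One_nat_def Suc_leI odd_pos)
  then show ?thesis using sum_card_poles by simp
qed

lemma sum_C_ge: "3 * card I \<le> (\<Sum>i\<in>I. card (C i))"
  using sum_mono[of I "\<lambda>_. 3" "\<lambda>i. card (C i)"] card_C_ge_3 by simp

text \<open>\<open>sum_C_ge\<close> is a termwise bound, so equality leaves no slack in any term;
  \<open>all_poles_1\<close> is the same argument for the poles.\<close>

lemma all_C_3:
  assumes "(\<Sum>i\<in>I. card (C i)) = 3 * card I" "i \<in> I"
  shows "card (C i) = 3"
proof (rule ccontr)
  assume "card (C i) \<noteq> 3"
  then have "3 < card (C i)" using card_C_ge_3[OF assms(2)] by simp
  then have "(\<Sum>i\<in>I. 3) < (\<Sum>i\<in>I. card (C i))"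
    using finite_I assms(2) card_C_ge_3 by (intro sum_strict_mono_ex1) auto
  then show False using assms(1) by simp
qed

lemma all_poles_1:
  assumes "2 * card I = card V" "v \<in> V"
  shows "card {i \<in> I. v \<in> poles i} = 1"
proof (rule ccontr)
  have ge: "1 \<le> card {i \<in> I. u \<in> poles i}" if "u \<in> V" for u
    using odd_poles[OF that] by (metis One_nat_def Suc_leI odd_pos)
  assume "card {i \<in> I. v \<in> poles i} \<noteq> 1"
  then have "1 < card {i \<in> I. v \<in> poles i}" using ge[OF assms(2)] by simp
  then have "(\<Sum>v\<in>V. 1) < (\<Sum>v\<in>V. card {i \<in> I. v \<in> poles i})"
    using finite_V assms(2) ge by (intro sum_strict_mono_ex1) auto
  then show False using sum_card_poles assms(1) by simp
qed

lemma card_V_ge_10: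
  assumes "V \<noteq> {}"
  shows "10 \<le> card V"
proof -
  have "9 * card V \<le> card V * (card V - 1)"
    using sum_card_L sum_C_ge card_V_le by linarith
  then have "card V * 9 \<le> card V * (card V - 1)" by (simp only: mult.commute)
  moreover have "card V > 0" using assms finite_V by (simp add: card_gt_0_iff)
  ultimately show ?thesis by simp
qed

lemma card_L_single_pole:
  assumes "v \<in> V" "card {i \<in> I. v \<in> poles i} = 1" "i \<in> I" "v \<in> poles i"
  shows "card (L v) + card (C i) + 4 * card {i \<in> I. v \<in> C i} = card V - 1"
proof -
  have "{i \<in> I. v \<in> poles i} = {i}"
    using assms(2-4) by (metis (mono_tags, lifting) card_1_singletonE mem_Collect_eq singletonD)
  then show ?thesis using card_L[OF assms(1)] by simp
qed

text \<open>Ten points leave no slack: five bipyramids with triangular rims use all 45 edges. The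
  degree equation 3 + 4m = 9 at a point then has no solution.\<close>

lemma card_V_noteq_10: "card V \<noteq> 10"
proof
  assume 10: "card V = 10"
  then obtain v where v: "v \<in> V" by fastforce
  have s: "(\<Sum>v\<in>V. card (L v)) + 6 * (\<Sum>i\<in>I. card (C i)) = 90" using sum_card_L 10 by simp
  then have I: "card I = 5" "(\<Sum>i\<in>I. card (C i)) = 3 * card I" "(\<Sum>v\<in>V. card (L v)) = 0"
    using sum_C_ge card_V_le 10 by linarith+
  then have "card (L v) = 0" using v finite_V by simp
  have "card {i \<in> I. v \<in> poles i} = 1" using all_poles_1 I 10 v by simp
  moreover from this obtain i where i: "i \<in> I" "v \<in> poles i" by (fastforce simp: card_1_singleton_iff)
  ultimately have "card (C i) + 4 * card {i \<in> I. v \<in> C i} = 9"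
    using card_L_single_pole v 10 \<open>card (L v) = 0\<close> by fastforce
  moreover have "card (C i) = 3" using all_C_3[OF I(2) i(1)] .
  ultimately show False by presburger
qed

text \<open>The degrees of b and of its neighbours compared with the total degree of
  \<open>L\<close> give several contradictions for 12 points.\<close>

lemma sum_L_ge:
  assumes "b \<in> V"
  shows "card (L b) + (\<Sum>w\<in>L b. card (L w)) \<le> (\<Sum>v\<in>V. card (L v))"
proof -
  have "(\<Sum>v\<in>insert b (L b). card (L v)) \<le> (\<Sum>v\<in>V. card (L v))"
    using assms L_V finite_V by (intro sum_mono2) auto
  moreover have "b \<notin> L b" using L_V by blast
  ultimately show ?thesis using finite_L by simp
qed

lemma N_rim_3:
  assumes "i \<in> I" "v \<in> C i" "card (C i) = 3"
  shows "N i v = poles i \<union> (C i - {v})"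
proof (rule card_subset_eq)
  show "finite (poles i \<union> (C i - {v}))" using finite_C finite_poles assms by simp
  show "N i v \<subseteq> poles i \<union> (C i - {v})" using N_rim assms by blast
  have "card (poles i \<union> (C i - {v})) = card (poles i) + card (C i - {v})"
    using poles_C finite_C finite_poles assms by (intro card_Un_disjoint) auto
  then show "card (N i v) = card (poles i \<union> (C i - {v}))"
    using N_rim assms card_poles by simp
qed

text \<open>The bound 22 and parity make all rims triangles, leaving total degree 6 in
  \<open>L\<close>. The 14 pole positions make one point v a pole three times and all others once,
  so v has degree 2 modulo 4 in \<open>L\<close> and all others 0 modulo 4. A neighbour b of v then
  has degree at least 4, and b with its neighbours already exceeds the total.\<close>

lemma not_seven_cells:
  assumes 12: "card V = 12" and I: "card I = 7"
  shows False
proof -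
  have s: "(\<Sum>v\<in>V. card (L v)) + 6 * (\<Sum>i\<in>I. card (C i)) = 132" using sum_card_L 12 by simp
  then have c: "(\<Sum>i\<in>I. card (C i)) = 3 * card I \<or> (\<Sum>i\<in>I. card (C i)) = 22"
    using sum_C_ge I by linarith
  have "even (\<Sum>i\<in>I. card (C i)) \<longleftrightarrow> even (card I)"
  proof -
    have "{i \<in> I. odd (card (C i))} = I" using odd_C by blast
    then show ?thesis using even_sum_iff[OF finite_I, of "\<lambda>i. card (C i)"] by simp
  qed
  then have c: "(\<Sum>i\<in>I. card (C i)) = 3 * card I" using c I by auto
  then have s6: "(\<Sum>v\<in>V. card (L v)) = 6" using s I by simp
  let ?pc = "\<lambda>v. card {i \<in> I. v \<in> poles i}"
  have eq: "card (L v) + 3 * ?pc v + 4 * card {i \<in> I. v \<in> C i} = 11" if "v \<in> V" for v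
    using card_L[OF that] all_C_3[OF c] 12 by simp
  have sp: "(\<Sum>v\<in>V. ?pc v) = 14" using sum_card_poles I by simp
  have ge: "1 \<le> ?pc u" if "u \<in> V" for u
    using odd_poles[OF that] by (metis One_nat_def Suc_leI odd_pos)
  have "\<exists>v\<in>V. ?pc v \<noteq> 1"
  proof (rule ccontr)
    assume "\<not> (\<exists>v\<in>V. ?pc v \<noteq> 1)"
    then have "(\<Sum>v\<in>V. ?pc v) = (\<Sum>v\<in>V. 1)" by (intro sum.cong) auto
    then show False using sp 12 by simp
  qed
  then obtain v where v: "v \<in> V" "?pc v \<noteq> 1" by blast
  then have pv: "?pc v = 3" using odd_poles[OF v(1)] eq[OF v(1)] by presburger
  have others: "?pc u = 1" if u: "u \<in> V" "u \<noteq> v" for u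
  proof -
    have "(\<Sum>w\<in>V. ?pc w) = ?pc v + (?pc u + (\<Sum>w\<in>V - {v} - {u}. ?pc w))"
      using u v finite_V by (simp add: sum.remove[of V v] sum.remove[of "V - {v}" u])
    moreover have "(\<Sum>w\<in>V - {v} - {u}. 1) \<le> (\<Sum>w\<in>V - {v} - {u}. ?pc w)"
      using ge by (intro sum_mono) auto
    moreover have "card (V - {v} - {u}) = 10" using u v 12 by simp
    ultimately have "?pc u \<le> 1" using sp pv by simp
    then show ?thesis using ge[OF u(1)] by simp
  qed
  have "card (L v) \<noteq> 0" using eq[OF v(1)] pv by presburger
  then obtain b where b: "b \<in> L v" by fastforce
  then have bV: "b \<in> V" "b \<noteq> v" using L_V by blast+
  have "v \<in> L b" using L_sym v b by blast
  then have "card (L b) \<noteq> 0" using finite_L by auto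
  then have b4: "4 \<le> card (L b)" using eq[OF bV(1)] others[OF bV] by presburger
  have "(\<Sum>w\<in>L b. 1) \<le> (\<Sum>w\<in>L b. card (L w))"
  proof (rule sum_mono)
    fix w assume "w \<in> L b"
    then have "b \<in> L w" using L_sym bV by blast
    then show "1 \<le> card (L w)" using finite_L by (metis One_nat_def Suc_leI card_gt_0_iff empty_iff)
  qed
  then show False using sum_L_ge[OF bV(1)] b4 s6 by simp
qed

end

section \<open>Twelve points with exactly six odd bipyramids\<close>

locale six_cells = odd_cells +
  assumes card_V: "card V = 12" and card_I: "card I = 6"
begin

lemma one_cell: "v \<in> V \<Longrightarrow> \<exists>i\<in>I. v \<in> poles i"
  using all_poles_1[of v] card_V card_I by (fastforce simp: card_1_singleton_iff)

lemma cell_unique: "i \<in> I \<Longrightarrow> j \<in> I \<Longrightarrow> v \<in> poles i \<Longrightarrow> v \<in> poles j \<Longrightarrow> i = j"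
proof -
  assume a: "i \<in> I" "j \<in> I" "v \<in> poles i" "v \<in> poles j"
  then have "v \<in> V" using poles_V by blast
  then obtain k where "{i \<in> I. v \<in> poles i} = {k}"
    using all_poles_1[of v] card_V card_I by (auto simp: card_1_singleton_iff)
  moreover have "i \<in> {i \<in> I. v \<in> poles i}" "j \<in> {i \<in> I. v \<in> poles i}" using a by simp_all
  ultimately show "i = j" by simp
qed

lemma card_L_eq: "i \<in> I \<Longrightarrow> v \<in> poles i \<Longrightarrow> card (L v) + card (C i) + 4 * card {i \<in> I. v \<in> C i} = 11"
  using card_L_single_pole[of v i] all_poles_1[of v] poles_V card_V card_I by auto

lemma sum_L_12: "(\<Sum>v\<in>V. card (L v)) + 6 * (\<Sum>i\<in>I. card (C i)) = 132"
  using sum_card_L card_V by simp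

lemma sum_C_cases: "(\<Sum>i\<in>I. card (C i)) \<in> {18, 20, 22}"
proof -
  have "{i \<in> I. odd (card (C i))} = I" using odd_C by blast
  then have "even (\<Sum>i\<in>I. card (C i))" using even_sum_iff[OF finite_I, of "\<lambda>i. card (C i)"] card_I by simp
  moreover have "18 \<le> (\<Sum>i\<in>I. card (C i))" "(\<Sum>i\<in>I. card (C i)) \<le> 22"
    using sum_C_ge card_I sum_L_12 by linarith+
  ultimately show ?thesis by (simp, presburger)
qed

text \<open>Six rims of length at least 3 exceed the minimum 18 by k - 3 in total, and a single rim
  of length at least k uses all of this excess.\<close>

lemma big_cell:
  assumes "(\<Sum>i\<in>I. card (C i)) = 15 + k" "k > 3" "\<And>i. i \<in> I \<Longrightarrow> card (C i) = 3 \<or> card (C i) \<ge> k"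
  obtains i where "i \<in> I" "card (C i) = k" "\<And>j. j \<in> I \<Longrightarrow> j \<noteq> i \<Longrightarrow> card (C j) = 3"
proof -
  have "\<exists>i\<in>I. card (C i) \<noteq> 3"
  proof (rule ccontr)
    assume "\<not> (\<exists>i\<in>I. card (C i) \<noteq> 3)"
    then have "(\<Sum>i\<in>I. card (C i)) = (\<Sum>i\<in>I. 3)" by (intro sum.cong) auto
    then show False using assms(1,2) card_I by simp
  qed
  then obtain i where i: "i \<in> I" "card (C i) \<ge> k" using assms(3) by blast
  have s: "(\<Sum>j\<in>I. card (C j)) = card (C i) + (\<Sum>j\<in>I - {i}. card (C j))"
    using finite_I i(1) by (rule sum.remove)
  have "(\<Sum>j\<in>I - {i}. 3) \<le> (\<Sum>j\<in>I - {i}. card (C j))"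
    using card_C_ge_3 by (intro sum_mono) auto
  then have 15: "15 \<le> (\<Sum>j\<in>I - {i}. card (C j))" using i(1) card_I finite_I by simp
  then have k: "card (C i) = k" "(\<Sum>j\<in>I - {i}. card (C j)) = 15" using s i(2) assms(1) by linarith+
  have "card (C j) = 3" if j: "j \<in> I" "j \<noteq> i" for j
  proof (rule ccontr)
    assume "card (C j) \<noteq> 3"
    then have "3 < card (C j)" using card_C_ge_3[OF j(1)] by simp
    then have "(\<Sum>j\<in>I - {i}. 3) < (\<Sum>j\<in>I - {i}. card (C j))"
      using finite_I j card_C_ge_3 by (intro sum_strict_mono_ex1) auto
    then show False using k(2) i(1) card_I finite_I by simp
  qed
  then show ?thesis using that i(1) k(1) by blast
qed

lemma L_nonempty: "w \<in> L b \<Longrightarrow> b \<in> V \<Longrightarrow> card (L w) > 0"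
  using L_sym finite_L by (metis card_gt_0_iff empty_iff)

text \<open>One rim is a pentagon, and modulo 4 the degree in \<open>L\<close> is 2 at its poles p,
  q and 0 elsewhere. A neighbour b of p other than q has degree at least 4, one of its neighbours
  also at least 4, and three more at least 2. This makes 14, but the total is 12.\<close>

lemma sum_C_noteq_20: "(\<Sum>i\<in>I. card (C i)) \<noteq> 20"
proof
  assume 20: "(\<Sum>i\<in>I. card (C i)) = 20"
  have "card (C i) = 3 \<or> card (C i) \<ge> 5" if "i \<in> I" for i
    using card_C_ge_3[OF that] odd_C[OF that] by presburger
  then obtain i where i: "i \<in> I" "card (C i) = 5" and j: "\<And>j. j \<in> I \<Longrightarrow> j \<noteq> i \<Longrightarrow> card (C j) = 3"
    using big_cell[of 5] 20 by auto
  have s12: "(\<Sum>v\<in>V. card (L v)) = 12" using sum_L_12 20 by simp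
  have four: "4 \<le> card (L w)" if w: "w \<in> V" "w \<notin> poles i" "card (L w) > 0" for w
  proof -
    obtain k where k: "k \<in> I" "w \<in> poles k" using one_cell w by blast
    then have "card (C k) = 3" using j w by blast
    then show ?thesis using card_L_eq[OF k] w(3) by presburger
  qed
  have two: "2 \<le> card (L w)" if w: "w \<in> V" "card (L w) > 0" for w
  proof (cases "w \<in> poles i")
    case True
    then show ?thesis using card_L_eq[OF i(1) True] i(2) by presburger
  qed (use four[OF w(1) _ w(2)] in auto)
  obtain p q where pq: "poles i = {p, q}" "p \<noteq> q" using card_poles[OF i(1)] by (auto simp: card_2_iff)
  have pi: "p \<in> poles i" using pq by simp
  have "2 \<le> card (L p)" using card_L_eq[OF i(1) pi] i(2) by presburger
  moreover have "card {q} = 1" by simp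
  ultimately have "\<not> L p \<subseteq> {q}" using card_mono[of "{q}" "L p"] by auto
  then obtain b where b: "b \<in> L p" "b \<noteq> q" by blast
  have pV: "p \<in> V" using poles_V[OF i(1)] pq by blast
  have bV: "b \<in> V" "b \<notin> poles i" using b L_V pq by blast+
  have b4: "4 \<le> card (L b)" using four[OF bV] L_nonempty[OF b(1) pV] by simp
  have "\<not> L b \<subseteq> poles i"
    using card_mono[OF finite_poles[OF i(1)], of "L b"] card_poles[OF i(1)] b4 by auto
  then obtain w where w: "w \<in> L b" "w \<notin> poles i" by blast
  have "4 \<le> card (L w)" using four[OF _ w(2)] L_nonempty[OF w(1) bV(1)] L_V w(1) by blast
  moreover have "(\<Sum>w\<in>L b - {w}. 2) \<le> (\<Sum>w\<in>L b - {w}. card (L w))"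
    using two L_nonempty bV(1) L_V by (intro sum_mono) blast
  moreover have "(\<Sum>w\<in>L b. card (L w)) = card (L w) + (\<Sum>w\<in>L b - {w}. card (L w))"
    using finite_L w(1) by (rule sum.remove)
  moreover have "card (L b - {w}) \<ge> 3" using b4 w(1) finite_L by simp
  ultimately show False using sum_L_ge[OF bV(1)] b4 s12 by simp
qed

text \<open>Here \<open>L\<close> is empty and one rim has 7 points.  The edges from its poles \<open>p\<close> and \<open>q\<close> to the three
  remaining points \<open>D\<close> must belong to one bipyramid on \<open>p\<close>, \<open>q\<close> and \<open>D\<close>; a point \<open>d\<close> of \<open>D\<close> is then a pole of a
  bipyramid whose rim and second pole form four points of the 7-point rim graph that are pairwise
  non-adjacent in it, too many for a 2-regular graph with 7 edges.\<close>

lemma sum_C_noteq_22: "(\<Sum>i\<in>I. card (C i)) \<noteq> 22"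
proof
  assume 22: "(\<Sum>i\<in>I. card (C i)) = 22"
  have "(\<Sum>v\<in>V. card (L v)) = 0" using sum_L_12 22 by simp
  then have L0: "card (L v) = 0" if "v \<in> V" for v using that finite_V by simp
  have eq11: "card (C i) + 4 * card {i \<in> I. v \<in> C i} = 11" if "i \<in> I" "v \<in> poles i" for i v
    using card_L_eq[OF that] L0 poles_V that by fastforce
  have "card (C i) = 3 \<or> card (C i) \<ge> 7" if i: "i \<in> I" for i
  proof -
    obtain v where "v \<in> poles i" using card_poles[OF i] by fastforce
    from eq11[OF i this] show ?thesis using card_C_ge_3[OF i] by presburger
  qed
  then obtain i where i: "i \<in> I" "card (C i) = 7" and C3: "\<And>j. j \<in> I \<Longrightarrow> j \<noteq> i \<Longrightarrow> card (C j) = 3"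
    using big_cell[of 7] 22 by auto
  obtain p q where pq: "poles i = {p, q}" "p \<noteq> q" using card_poles[OF i(1)] by (auto simp: card_2_iff)
  have pqV: "p \<in> V" "q \<in> V" using poles_V[OF i(1)] pq by auto
  have pqC: "p \<notin> C i" "q \<notin> C i" using poles_C[OF i(1)] pq by auto
  define D where "D = V - {p, q} - C i"
  \<comment> \<open>The degree equation at p reads 7 + 4m = 11.\<close>
  have "card {k \<in> I. p \<in> C k} = 1" using eq11[OF i(1), of p] pq i(2) by simp
  then obtain j where j: "j \<in> I" "p \<in> C j" by (fastforce simp: card_1_singleton_iff)
  have "j \<noteq> i" using j pqC by blast
  have Cj: "card (C j) = 3" using C3[OF j(1) \<open>j \<noteq> i\<close>] .
  have Nj: "N j p = poles j \<union> (C j - {p})" using N_rim_3[OF j Cj] .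
  have poles_j: "p \<notin> poles j" "q \<notin> poles j"
    using cell_unique[OF i(1) j(1)] pq \<open>j \<noteq> i\<close> by auto
  have "N j p \<inter> N i p = {}" using N_disjoint j(1) i(1) \<open>j \<noteq> i\<close> by blast
  then have "N j p \<inter> C i = {}" using N_pole[OF i(1), of p] pq by simp
  \<comment> \<open>\<open>N j p\<close> has four points, as many as q and D together, so the
    inclusion will turn out to be an equality.\<close>
  then have sub: "N j p \<subseteq> insert q D" using N_V[OF j(1), of p] by (auto simp: D_def)
  have "card D = 3"
  proof -
    have "card (V - ({p, q} \<union> C i)) = card V - card ({p, q} \<union> C i)"
      using pqV C_V[OF i(1)] finite_C[OF i(1)] by (intro card_Diff_subset) auto
    moreover have "card ({p, q} \<union> C i) = card {p, q} + card (C i)"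
      using pqC finite_C[OF i(1)] by (intro card_Un_disjoint) auto
    moreover have "D = V - ({p, q} \<union> C i)" by (auto simp: D_def)
    ultimately show ?thesis using card_V i(2) pq(2) by simp
  qed
  moreover have "finite D" "q \<notin> D" using finite_V by (auto simp: D_def)
  ultimately have Nj': "N j p = insert q D"
    using card_subset_eq[OF _ sub] N_rim[OF j] by simp
  then have qC: "q \<in> C j" using Nj poles_j by blast
  have "card (C j - {p, q}) = 1" using Cj j(2) qC pq(2) finite_C[OF j(1)] by simp
  then obtain d where d: "C j - {p, q} = {d}" by (auto simp: card_1_singleton_iff)
  have dD: "d \<in> D" and dp: "d \<notin> poles j" using d Nj Nj' poles_C[OF j(1)] by blast+
  have Cj_eq: "C j = {p, q, d}" using d j(2) qC by blast
  have D_eq: "D = insert d (poles j)"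
  proof -
    have "insert q D = poles j \<union> {q, d}" using Nj Nj' Cj_eq pq(2) dD by (auto simp: D_def)
    moreover have "q \<notin> insert d (poles j)" using poles_j pq(2) dD \<open>q \<notin> D\<close> by auto
    moreover have "insert q D = insert q (insert d (poles j))" using calculation(1) by simp
    ultimately show ?thesis using \<open>q \<notin> D\<close> by (metis insert_ident)
  qed
  have dV: "d \<in> V" and d_ne: "d \<noteq> p" "d \<noteq> q" "d \<notin> C i" using dD by (auto simp: D_def)
  obtain t where t: "t \<in> I" "d \<in> poles t" using one_cell[OF dV] by blast
  have tj: "t \<noteq> j" using t dp by blast
  have ti: "t \<noteq> i" using t pq d_ne by blast
  have Ct: "card (C t) = 3" using C3[OF t(1) ti] .
  have Njd: "N j d = poles j \<union> {p, q}"
    using N_rim_3[OF j(1), of d] Cj Cj_eq d_ne by auto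
  have "N t d \<inter> N j d = {}" using N_disjoint t(1) j(1) tj by blast
  \<comment> \<open>In t the pole d is joined to all of \<open>C t\<close>, in j to the points of
    \<open>N j d\<close>; no edge lies in two bipyramids.\<close>
  then have "C t \<inter> (poles j \<union> {p, q}) = {}" using N_pole[OF t] Njd by simp
  moreover have "d \<notin> C t" using poles_C[OF t(1)] t(2) by blast
  ultimately have CtC: "C t \<subseteq> C i" using C_V[OF t(1)] D_eq by (auto simp: D_def)
  obtain e where e: "poles t = {d, e}" "e \<noteq> d"
  proof -
    obtain a b where "poles t = {a, b}" "a \<noteq> b" using card_poles[OF t(1)] by (auto simp: card_2_iff)
    then show ?thesis using t(2) that[of a] that[of b] by auto
  qed
  have "e \<notin> poles i" "e \<notin> poles j" using cell_unique[OF t(1) i(1)] cell_unique[OF t(1) j(1)] ti tj e by auto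
  moreover have "e \<in> V" using poles_V[OF t(1)] e by blast
  ultimately have eC: "e \<in> C i" using D_eq e(2) pq by (auto simp: D_def)
  define K where "K = insert e (C t)"
  have eCt: "e \<notin> C t" using poles_C[OF t(1)] e by blast
  have KC: "K \<subseteq> C i" and card_K: "card K = 4"
    using CtC eC eCt Ct finite_C[OF t(1)] by (auto simp: K_def)
  have KN: "K - {v} \<subseteq> N t v" if "v \<in> K" for v
  proof (cases "v = e")
    case True
    then show ?thesis using N_pole[OF t(1), of e] e by (auto simp: K_def)
  next
    case False
    then have "v \<in> C t" using that by (simp add: K_def)
    then show ?thesis using N_rim_3[OF t(1) _ Ct] e by (auto simp: K_def)
  qed
  define M where "M = C i - K"
  have fin: "finite K" "finite M" using finite_C[OF i(1)] finite_C[OF t(1)] by (simp_all add: K_def M_def)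
  have card_M: "card M = 3" using card_Diff_subset[OF fin(1) KC] card_K i(2) by (simp add: M_def)
  have two: "card (N i v - poles i) = 2" if v: "v \<in> C i" for v
    using N_rim[OF i(1) v] card_Diff_subset[OF finite_poles[OF i(1)], of "N i v"] card_poles[OF i(1)] by simp
  have "card {w \<in> M. w \<in> N i v} = 2" if v: "v \<in> K" for v
  proof -
    have "N i v \<inter> N t v = {}" using N_disjoint i(1) t(1) ti by blast
    moreover have "v \<notin> N i v" using N_V[OF i(1)] by blast
    ultimately have "N i v \<inter> K = {}" using KN[OF v] by blast
    then have "{w \<in> M. w \<in> N i v} = N i v - poles i"
      using N_rim[OF i(1), of v] KC v poles_C[OF i(1)] by (auto simp: M_def)
    then show ?thesis using two KC v by auto
  qed
  \<comment> \<open>Rim edges of i between K and M: each of the four points of K has both rim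
    neighbours in M, but the three points of M have only six places.\<close>
  then have "(\<Sum>v\<in>K. card {w \<in> M. w \<in> N i v}) = 8" using card_K by simp
  moreover have "(\<Sum>v\<in>K. card {w \<in> M. w \<in> N i v}) = (\<Sum>w\<in>M. card {v \<in> K. w \<in> N i v})"
    using sum_card_rel[OF fin, of "\<lambda>w v. w \<in> N i v"] .
  moreover have "(\<Sum>w\<in>M. card {v \<in> K. w \<in> N i v}) \<le> (\<Sum>w\<in>M. 2)"
  proof (rule sum_mono)
    fix w assume "w \<in> M"
    then have w: "w \<in> C i" by (simp add: M_def)
    have "{v \<in> K. w \<in> N i v} \<subseteq> N i w - poles i"
      using N_sym[OF i(1)] KC poles_C[OF i(1)] by auto
    then have "card {v \<in> K. w \<in> N i v} \<le> card (N i w - poles i)"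
      using finite_N[OF i(1)] by (intro card_mono) auto
    then show "card {v \<in> K. w \<in> N i v} \<le> 2" using two[OF w] by simp
  qed
  ultimately show False using card_M by simp
qed

text \<open>Here all rims are triangles and \<open>L\<close> is a 4-regular graph on a set \<open>X\<close> of six points.  Counting
  the edges inside \<open>X\<close> shows that three bipyramids have both poles in \<open>X\<close> and the rim in \<open>Y = V - X\<close>,
  while the other three have both poles and one rim point in \<open>Y\<close>.\<close>

lemma sum_C_noteq_18: "(\<Sum>i\<in>I. card (C i)) \<noteq> 18"
proof
  assume 18: "(\<Sum>i\<in>I. card (C i)) = 18"
  have s24: "(\<Sum>v\<in>V. card (L v)) = 24" using sum_L_12 18 by simp
  have C3: "card (C i) = 3" if "i \<in> I" for i using all_C_3[OF _ that] 18 card_I by simp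
  have eq8: "card (L v) + 4 * card {i \<in> I. v \<in> C i} = 8" if v: "v \<in> V" for v
  proof -
    obtain i where i: "i \<in> I" "v \<in> poles i" using one_cell[OF v] by blast
    show ?thesis using card_L_eq[OF i] C3[OF i(1)] by simp
  qed
  have four: "4 \<le> card (L v)" if "v \<in> V" "card (L v) > 0" for v
    using eq8[OF that(1)] that(2) by presburger
  have not8: "card (L v) \<noteq> 8" if v: "v \<in> V" for v
  proof
    assume 8: "card (L v) = 8"
    have "(\<Sum>w\<in>L v. 4) \<le> (\<Sum>w\<in>L v. card (L w))"
      using four L_nonempty v L_V by (intro sum_mono) blast
    then show False using sum_L_ge[OF v] 8 s24 by simp
  qed
  define X where "X = {v \<in> V. card (L v) > 0}"
  define Y where "Y = V - X"
  have X_V: "X \<subseteq> V" and finX: "finite X" using finite_V by (auto simp: X_def)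
  have LX: "card (L v) = 4" "card {i \<in> I. v \<in> C i} = 1" if v: "v \<in> X" for v
  proof -
    have vV: "v \<in> V" "card (L v) > 0" using v by (simp_all add: X_def)
    show "card (L v) = 4" "card {i \<in> I. v \<in> C i} = 1"
      using eq8[OF vV(1)] four[OF vV] not8[OF vV(1)] by presburger+
  qed
  have LY: "L v = {}" if "v \<in> Y" for v
    using that finite_L by (simp add: Y_def X_def card_gt_0_iff)
  have "(\<Sum>v\<in>V. card (L v)) = (\<Sum>v\<in>X. card (L v))"
    using finite_V by (intro sum.mono_neutral_right) (auto simp: X_def)
  also have "\<dots> = 4 * card X" using LX(1) by simp
  finally have cX: "card X = 6" using s24 by simp
  have cY: "card Y = 6" using card_Diff_subset[OF finX X_V] cX card_V by (simp add: Y_def)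
  define tau pi where "tau i = card (C i \<inter> X)" and "pi i = card (poles i \<inter> X)" for i
  have "(\<Sum>v\<in>X. card {i \<in> I. v \<in> C i}) = (\<Sum>i\<in>I. card {v \<in> X. v \<in> C i})"
    using sum_card_rel[OF finX finite_I, of "\<lambda>i v. v \<in> C i"] .
  moreover have "{v \<in> X. v \<in> C i} = C i \<inter> X" for i by blast
  ultimately have s_tau: "(\<Sum>i\<in>I. tau i) = 6" using LX(2) cX by (simp add: tau_def)
  have "(\<Sum>v\<in>X. card {i \<in> I. v \<in> poles i}) = (\<Sum>i\<in>I. card {v \<in> X. v \<in> poles i})"
    using sum_card_rel[OF finX finite_I, of "\<lambda>i v. v \<in> poles i"] .
  moreover have "{v \<in> X. v \<in> poles i} = poles i \<inter> X" for i by blast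
  moreover have "card {i \<in> I. v \<in> poles i} = 1" if "v \<in> X" for v
    using that X_V all_poles_1 card_V card_I by auto
  ultimately have s_pi: "(\<Sum>i\<in>I. pi i) = 6" using cX by (simp add: pi_def)
  \<comment> \<open>Of the five other points of X, four are joined to v by \<open>L\<close>.\<close>
  have inX: "(\<Sum>i\<in>I. card (N i v \<inter> X)) = 1" if v: "v \<in> X" for v
  proof -
    have "L v \<subseteq> X" using L_nonempty L_V v X_V by (auto simp: X_def)
    have "card (\<Union>i\<in>I. N i v \<inter> X) = (\<Sum>i\<in>I. card (N i v \<inter> X))"
      using finite_I finX N_disjoint by (intro card_UN_disjoint) blast+
    moreover have "(\<Union>i\<in>I. N i v \<inter> X) = X - {v} - L v"
      using N_V X_V by (auto simp: L_def)
    moreover have "card (X - {v} - L v) = card (X - {v}) - card (L v)"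
      using \<open>L v \<subseteq> X\<close> finite_L L_V by (intro card_Diff_subset) auto
    ultimately show ?thesis using LX(1)[OF v] v cX by simp
  qed
  \<comment> \<open>Ordered adjacent pairs of i inside X: pole and rim point in both orders, and any
    two points of the triangular rim. The poles are not adjacent in i.\<close>
  have F: "(\<Sum>v\<in>X. card (N i v \<inter> X)) = 2 * pi i * tau i + tau i * (tau i - 1)" if i: "i \<in> I" for i
  proof -
    have "card (N i v \<inter> X) = (if v \<in> poles i then tau i else 0) + (if v \<in> C i then pi i + (tau i - 1) else 0)"
      if v: "v \<in> X" for v
    proof -
      consider "v \<in> poles i" "v \<notin> C i" | "v \<in> C i" "v \<notin> poles i" | "v \<notin> poles i" "v \<notin> C i"
        using poles_C[OF i] by blast
      then show ?thesis
      proof cases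
        case 1
        then show ?thesis using N_pole[OF i] by (simp add: tau_def)
      next
        case 2
        have "N i v \<inter> X = (poles i \<inter> X) \<union> (C i \<inter> X - {v})" using N_rim_3[OF i 2(1) C3[OF i]] by blast
        also have "card \<dots> = card (poles i \<inter> X) + card (C i \<inter> X - {v})"
          using poles_C[OF i] finX by (intro card_Un_disjoint) auto
        finally show ?thesis using 2 v finX by (simp add: tau_def pi_def)
      next
        case 3
        then show ?thesis using N_other[OF i] by simp
      qed
    qed
    then have "(\<Sum>v\<in>X. card (N i v \<inter> X)) = (\<Sum>v\<in>X. if v \<in> poles i then tau i else 0)
        + (\<Sum>v\<in>X. if v \<in> C i then pi i + (tau i - 1) else 0)"
      by (simp add: sum.distrib)
    also have "\<dots> = pi i * tau i + tau i * (pi i + (tau i - 1))"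
      using finX by (simp add: sum.If_cases tau_def pi_def Int_commute Collect_conj_eq)
    finally show ?thesis by (simp add: add_mult_distrib2 mult.commute)
  qed
  have "(\<Sum>i\<in>I. 2 * pi i * tau i + tau i * (tau i - 1)) = (\<Sum>i\<in>I. \<Sum>v\<in>X. card (N i v \<inter> X))"
    using F by simp
  also have "\<dots> = (\<Sum>v\<in>X. \<Sum>i\<in>I. card (N i v \<inter> X))" by (rule sum.swap)
  also have "\<dots> = 6" using inX cX by simp
  finally have s_F: "(\<Sum>i\<in>I. 2 * pi i * tau i + tau i * (tau i - 1)) = 6" .
  have le: "tau i \<le> 3" "pi i \<le> 2" if "i \<in> I" for i
    using card_mono[OF finite_C[OF that], of "C i \<inter> X"] C3[OF that]
      card_mono[OF finite_poles[OF that], of "poles i \<inter> X"] card_poles[OF that]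
    by (simp_all add: tau_def pi_def)
  \<comment> \<open>The weights 3, 2 and the constant 4 make the bound below hold for all possible
    values, with equality only at (2, 0) and (0, 2) for (tau, pi). Both totals are 30, since 6 + 4 *
    6 = 3 * 6 + 2 * 6, so equality holds in every term.\<close>
  let ?h = "\<lambda>i. 2 * pi i * tau i + tau i * (tau i - 1) + 4"
  have h_cases: "3 * tau i + 2 * pi i \<le> ?h i \<and>
      (?h i = 3 * tau i + 2 * pi i \<longrightarrow> tau i = 2 \<and> pi i = 0 \<or> tau i = 0 \<and> pi i = 2)" if i: "i \<in> I" for i
  proof -
    have "tau i \<in> {0, 1, 2, 3}" "pi i \<in> {0, 1, 2}" using le[OF i] by (simp_all, linarith+)
    then show ?thesis by auto
  qed
  have "(\<Sum>i\<in>I. ?h i) = 30" using s_F card_I by (simp add: sum.distrib)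
  moreover have "(\<Sum>i\<in>I. 3 * tau i + 2 * pi i) = 30"
    using s_tau s_pi by (simp add: sum.distrib sum_distrib_left[symmetric])
  ultimately have sums: "(\<Sum>i\<in>I. ?h i) = (\<Sum>i\<in>I. 3 * tau i + 2 * pi i)" by simp
  have type: "tau i = 2 \<and> pi i = 0 \<or> tau i = 0 \<and> pi i = 2" if i: "i \<in> I" for i
  proof (rule ccontr)
    assume "\<not> ?thesis"
    then have "3 * tau i + 2 * pi i < ?h i" using h_cases[OF i] by linarith
    then have "(\<Sum>i\<in>I. 3 * tau i + 2 * pi i) < (\<Sum>i\<in>I. ?h i)"
      using finite_I i h_cases by (intro sum_strict_mono_ex1) auto
    then show False using sums by simp
  qed
  define B where "B = {i \<in> I. tau i = 2}"
  have "(\<Sum>i\<in>I. tau i) = (\<Sum>i\<in>B. tau i)"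
    using finite_I by (intro sum.mono_neutral_right) (auto simp: B_def dest: type)
  then have cB: "card B = 3" using s_tau by (simp add: B_def)
  have BI: "B \<subseteq> I" and finB: "finite B" using finite_I by (auto simp: B_def)
  have poles_B: "poles i \<subseteq> Y" if "i \<in> B" for i
  proof -
    have "pi i = 0" using type[of i] that by (auto simp: B_def)
    then show ?thesis using finX poles_V[of i] that BI by (auto simp: pi_def Y_def)
  qed
  have A: "poles i \<subseteq> X \<and> C i \<subseteq> Y" if "i \<in> I" "i \<notin> B" for i
  proof -
    have "tau i = 0" "pi i = 2" using type[OF that(1)] that by (auto simp: B_def)
    then have "C i \<inter> X = {}" "poles i \<inter> X = poles i"
      using finX card_subset_eq[OF finite_poles[OF that(1)], of "poles i \<inter> X"] card_poles[OF that(1)]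
      by (simp_all add: tau_def pi_def)
    then show ?thesis using C_V[OF that(1)] by (auto simp: Y_def)
  qed
  have CY: "card (C i \<inter> Y) = 1" if "i \<in> B" for i
  proof -
    have iI: "i \<in> I" using that BI by blast
    have "C i \<inter> Y = C i - (C i \<inter> X)" using C_V[OF iI] by (auto simp: Y_def)
    then show ?thesis
      using card_Diff_subset[of "C i \<inter> X" "C i"] finX C3[OF iI] that by (simp add: B_def tau_def)
  qed
  have pole_B: "i \<in> B" if "i \<in> I" "v \<in> poles i" "v \<in> Y" for i v
    using A[OF that(1)] that by (auto simp: Y_def)
  \<comment> \<open>The edge \<open>t u\<close> lies in the rim of some \<open>m\<close> outside \<open>B\<close>, which determines \<open>i\<close> in \<open>B\<close>; the
    third rim point \<open>w\<close> of \<open>m\<close> is a pole of \<open>r\<close>, so that \<open>t w\<close> lies both in \<open>m\<close> and in \<open>r\<close>.\<close>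
  obtain r where r: "r \<in> B" using cB by fastforce
  then have rI: "r \<in> I" using BI by blast
  obtain t where t: "C r \<inter> Y = {t}" using CY[OF r] by (auto simp: card_1_singleton_iff)
  then have tC: "t \<in> C r" and tY: "t \<in> Y" by blast+
  have tV: "t \<in> V" using tY by (simp add: Y_def)
  obtain k where k: "k \<in> I" "t \<in> poles k" using one_cell[OF tV] by blast
  have kB: "k \<in> B" using pole_B k tY by blast
  have kr: "k \<noteq> r" using k tC poles_C[OF rI] by blast
  obtain u where u: "poles k = {t, u}" "u \<noteq> t"
  proof -
    obtain a b where "poles k = {a, b}" "a \<noteq> b" using card_poles[OF k(1)] by (auto simp: card_2_iff)
    then show ?thesis using k(2) that[of a] that[of b] by auto
  qed
  have uY: "u \<in> Y" using poles_B[OF kB] u by blast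
  then have "u \<in> V - {t}" using u by (auto simp: Y_def)
  then obtain m where m: "m \<in> I" "u \<in> N m t" using LY[OF tY] unfolding L_def by blast
  have "t \<notin> poles m"
  proof
    assume "t \<in> poles m"
    moreover from this have "k = m" using cell_unique[OF k(1) m(1)] k(2) by blast
    ultimately show False using m(2) N_pole[OF m(1)] u(1) poles_C[OF m(1)] by blast
  qed
  moreover have "u \<notin> poles m"
  proof
    assume "u \<in> poles m"
    moreover from this have "k = m" using cell_unique[OF k(1) m(1), of u] u(1) by blast
    ultimately show False using N_sym[OF m] N_pole[OF m(1)] u(1) poles_C[OF m(1)] by blast
  qed
  ultimately have m_poles: "t \<notin> poles m" "u \<notin> poles m" .
  have tm: "t \<in> C m" using N_other[OF m(1), of t] m(2) m_poles by auto
  have um: "u \<in> C m" using N_other[OF m(1), of u] N_sym[OF m] m_poles by auto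
  have mB: "m \<notin> B"
  proof
    assume "m \<in> B"
    then obtain x where "C m \<inter> Y = {x}" using CY by (auto simp: card_1_singleton_iff)
    moreover have "t \<in> C m \<inter> Y" "u \<in> C m \<inter> Y" using tm um tY uY by simp_all
    ultimately show False using u(2) by simp
  qed
  obtain x where x: "x \<in> poles m" using card_poles[OF m(1)] by fastforce
  have xX: "x \<in> X" using A[OF m(1) mB] x by blast
  obtain i where i: "i \<in> I" "x \<in> C i" using LX(2)[OF xX] by (fastforce simp: card_1_singleton_iff)
  have "i \<in> B" using A[OF i(1)] i(2) xX by (auto simp: Y_def)
  have im: "i \<noteq> m" using \<open>i \<in> B\<close> mB by blast
  \<comment> \<open>The pole x is joined within m to all of \<open>C m\<close>, so none of its
    neighbours in i lies there; this separates i from k and r.\<close>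
  have "N i x \<inter> N m x = {}" using N_disjoint i(1) m(1) im by blast
  then have disj: "C m \<inter> (poles i \<union> (C i - {x})) = {}"
    using N_rim_3[OF i C3[OF i(1)]] N_pole[OF m(1) x] by blast
  have ik: "i \<noteq> k" using disj u tm by blast
  have ir: "i \<noteq> r" using disj tm tC xX tY by (auto simp: Y_def)
  have "{i, k, r} \<subseteq> B" "card {i, k, r} = card B" using \<open>i \<in> B\<close> kB r ik ir kr cB by auto
  then have B_eq: "B = {i, k, r}" using card_subset_eq[OF finB] by metis
  have "card (C m - {t, u}) = 1" using C3[OF m(1)] tm um u finite_C[OF m(1)] by simp
  then obtain w where "C m - {t, u} = {w}" by (auto simp: card_1_singleton_iff)
  then have w: "w \<in> C m" "w \<noteq> t" "w \<noteq> u" by blast+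
  have wY: "w \<in> Y" using A[OF m(1) mB] w by blast
  then obtain l where l: "l \<in> I" "w \<in> poles l" using one_cell[of w] by (auto simp: Y_def)
  have "l \<in> B" using pole_B l wY by blast
  moreover have "l \<noteq> k" using l u w by blast
  moreover have "l \<noteq> i" using disj l w by blast
  ultimately have "w \<in> poles r" using B_eq l by blast
  then have "w \<in> N r t" using N_rim[OF rI tC] by blast
  moreover have "w \<in> N m t" using N_rim_3[OF m(1) tm C3[OF m(1)]] w by blast
  moreover have "r \<noteq> m" using r mB by blast
  ultimately show False using N_disjoint[OF rI m(1)] by blast
qed

lemma six_cells_False: False
  using sum_C_cases sum_C_noteq_18 sum_C_noteq_20 sum_C_noteq_22 by blast

end

lemma (in odd_cells) card_V_notin: "V \<noteq> {} \<Longrightarrow> card V \<notin> {4, 6, 10, 12}"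
proof -
  assume "V \<noteq> {}"
  moreover have "card V \<noteq> 12"
  proof
    assume 12: "card V = 12"
    have "3 * card I \<le> 22" using sum_card_L sum_C_ge 12 by simp
    moreover have "6 \<le> card I" using card_V_le 12 by simp
    moreover have "card I \<noteq> 7" using not_seven_cells 12 by blast
    ultimately have "card I = 6" by simp
    with 12 interpret six_cells V I poles C N by unfold_locales
    show False by (rule six_cells_False)
  qed
  ultimately show ?thesis using card_V_ge_10 card_V_noteq_10 by fastforce
qed

section \<open>The bipyramids of a flexible system\<close>

lemma even_card_involution:
  assumes "finite A" "\<And>x. x \<in> A \<Longrightarrow> f x \<in> A \<and> f x \<noteq> x \<and> f (f x) = x"
  shows "even (card A)"
  using assms
proof (induction "card A" arbitrary: A rule: less_induct)
  case less
  show ?case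
  proof (cases "A = {}")
    case False
    then obtain x where x: "x \<in> A" by blast
    note fx = less.prems(2)[OF x]
    let ?A = "A - {x, f x}"
    have "even (card ?A)"
    proof (rule less.hyps)
      show "card ?A < card A" using x less.prems(1) by (intro psubset_card_mono) auto
      show "f y \<in> ?A \<and> f y \<noteq> y \<and> f (f y) = y" if "y \<in> ?A" for y
        using that less.prems(2)[of y] fx by auto
    qed (use less.prems in simp)
    moreover have "card A = card ?A + 2"
    proof -
      have "{x, f x} \<subseteq> A" "card {x, f x} = 2" using fx x by auto
      then show ?thesis
        using card_Diff_subset[of "{x, f x}" A] card_mono[OF less.prems(1), of "{x, f x}"] by simp
    qed
    ultimately show ?thesis by simp
  qed simp
qed

context flexible_system
begin

text \<open>The rim points of the bipyramid with poles \<open>y\<close> and \<open>u\<close>, for \<open>y \<noteq> u\<close>.\<close>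

definition rim :: "'a \<Rightarrow> 'a \<Rightarrow> 'a set" where
  "rim y u = {x. \<exists>z w. (w, y, x) \<in> B \<and> (x, y, z) \<in> B \<and> (x, u, w) \<in> B \<and> (z, u, x) \<in> B}"

text \<open>A rim edge with the orientation given by p; reversing it exchanges the poles.\<close>

definition link :: "'a \<Rightarrow> 'a \<Rightarrow> 'a \<Rightarrow> 'a \<Rightarrow> bool" where
  "link p q a b \<longleftrightarrow> (a, p, b) \<in> B \<and> (b, q, a) \<in> B"

lemma rim_sym: "rim y u = rim u y"
  unfolding rim_def by blast

lemma rim_V: "rim y u \<subseteq> V - {y, u}"
  using distinct_block unfolding rim_def by blast

lemma rim_unique: "x \<in> rim y u \<Longrightarrow> x \<in> rim y u' \<Longrightarrow> u = u'"
  unfolding rim_def using unique_last unique_outer by blast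

text \<open>An edge between pole and rim cannot also be one with the roles exchanged, nor a rim edge
  by the next lemma: the pair would occur in two different places of blocks. This keeps distinct
  bipyramids edge-disjoint.\<close>

lemma rim_nonsym: "c \<in> rim p q \<Longrightarrow> p \<notin> rim c q'"
  unfolding rim_def using not_first_last by blast

lemma rim_not_link: "c \<in> rim p q \<Longrightarrow> \<not> link p' q' p c" "c \<in> rim p q \<Longrightarrow> \<not> link p' q' c p"
  unfolding rim_def link_def using not_last_outer by blast+

lemma link_rim:
  assumes "link p q a b"
  shows "b \<in> rim p q" "a \<in> rim p q"
proof -
  have step: "y \<in> rim p q" if xy: "(x, p, y) \<in> B" "(y, q, x) \<in> B" for p q x y
  proof -
    obtain z where z: "(y, p, z) \<in> B" using block_after[OF xy(1)] by blast
    then obtain u w where uw: "(w, p, y) \<in> B" "(y, u, w) \<in> B" "(z, u, y) \<in> B"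
      using flexible_block by blast
    have "w = x" using unique_last[OF uw(1) xy(1)] .
    then have "u = q" using unique_outer[of y u x q] uw(2) xy(2) by simp
    then show ?thesis using z uw \<open>w = x\<close> unfolding rim_def by blast
  qed
  show "b \<in> rim p q" "a \<in> rim p q"
    using step assms rim_sym unfolding link_def by blast+
qed

lemma link_unique: "link p q a b \<Longrightarrow> link p' q' a b \<Longrightarrow> p = p' \<and> q = q'"
  unfolding link_def using unique_outer by blast+

lemma odd_number_of_odd_rims:
  assumes y: "y \<in> V" and even: "even (card V)"
  shows "odd (card {u \<in> V - {y}. odd (card (rim y u))})"
proof -
  let ?U = "\<Union>u\<in>V - {y}. rim y u"
  define D where "D = V - {y} - ?U"
  have inD: "x \<in> D" if "x \<in> V" "x \<noteq> y" "\<And>u. u \<noteq> y \<Longrightarrow> x \<notin> rim y u" for x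
    using that by (auto simp: D_def)
  \<comment> \<open>Multiplication by \<open>y\<close> pairs off the points that are on no rim around \<open>y\<close>.\<close>
  have "dts_op B y x \<in> D \<and> dts_op B y x \<noteq> x \<and> dts_op B y (dts_op B y x) = x" if x: "x \<in> D" for x
  proof -
    have xV: "x \<in> V" "x \<noteq> y" using x by (auto simp: D_def)
    consider b where "(y, x, b) \<in> B" | b where "(y, b, x) \<in> B" | w where "(w, y, x) \<in> B"
      using block_cases[of y x] xV y by metis
    then show ?thesis
    proof cases
      case (1 b)
      note d = distinct_block[OF 1]
      have "b \<notin> rim y u" for u using not_last_outer 1 unfolding rim_def by blast
      then have "b \<in> D" using inD d by blast
      then show ?thesis using dts_op_block[OF 1] d by auto
    next
      case (2 b)
      note d = distinct_block[OF 2]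
      have "b \<notin> rim y u" for u using not_first_last 2 unfolding rim_def by blast
      then have "b \<in> D" using inD d by blast
      then show ?thesis using dts_op_block[OF 2] d by auto
    next
      case (3 w)
      note d = distinct_block[OF 3]
      obtain z where z: "(x, y, z) \<in> B" using block_after[OF 3] by blast
      then obtain u w' where u: "(w', y, x) \<in> B" "(x, u, w') \<in> B" "(z, u, x) \<in> B"
        using flexible_block by blast
      have "w' = w" using unique_last[OF u(1) 3] .
      then have "x \<in> rim y u" using 3 z u unfolding rim_def by blast
      moreover have "u \<in> V" using distinct_block[OF u(2)] by blast
      \<comment> \<open>Off all rims around y, the second pole is y itself: {x, y, w} is a triangle
        whose blocks have y in the middle.\<close>
      ultimately have "u = y" using x by (auto simp: D_def)
      then have xyw: "(x, y, w) \<in> B" using u(2) \<open>w' = w\<close> by simp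
      have "w \<notin> rim y u" if "u \<noteq> y" for u
      proof
        assume "w \<in> rim y u"
        then obtain z2 w2 where "(w2, y, w) \<in> B" "(w, y, z2) \<in> B" "(w, u, w2) \<in> B" unfolding rim_def by blast
        then show False using unique_last[of w2 y w x] xyw unique_outer[of w u x y] 3 that by auto
      qed
      then have "w \<in> D" using inD d by blast
      then show ?thesis using dts_op_block(2)[OF 3] dts_op_block(2)[OF xyw] d by auto
    qed
  qed
  then have even_D: "even (card D)" using finite_V by (intro even_card_involution[of D "dts_op B y"]) (auto simp: D_def)
  have card_D: "card D = card (V - {y}) - card ?U"
    unfolding D_def using finite_V rim_V finite_subset[of "rim y _" V]
    by (intro card_Diff_subset) (blast intro: finite_subset[of "?U" V])+
  have "card ?U \<le> card (V - {y})" using finite_V rim_V by (intro card_mono) blast+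
  with card_D have "card (V - {y}) = card D + card ?U" by simp
  moreover have "odd (card (V - {y}))" using y even finite_V by (auto simp: card_gt_0_iff)
  ultimately have "odd (card ?U)" using even_D by simp
  moreover have "card ?U = (\<Sum>u\<in>V - {y}. card (rim y u))"
  proof (rule card_UN_disjoint)
    show "\<forall>u\<in>V - {y}. finite (rim y u)"
      using rim_V finite_V by (meson Diff_subset finite_subset order_trans)
    show "\<forall>u\<in>V - {y}. \<forall>u'\<in>V - {y}. u \<noteq> u' \<longrightarrow> rim y u \<inter> rim y u' = {}"
      using rim_unique by blast
  qed (use finite_V in simp)
  ultimately show ?thesis using even_sum_iff[of "V - {y}" "\<lambda>u. card (rim y u)"] finite_V by simp
qed

text \<open>The set P of poles is unordered so that every bipyramid is indexed once; the quantifiers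
  run over both orders of its poles.\<close>

definition adjacent :: "'a set \<Rightarrow> 'a \<Rightarrow> 'a \<Rightarrow> bool" where
  "adjacent P v x \<longleftrightarrow>
     (\<exists>p q. P = {p, q} \<and> p \<noteq> q \<and> (v = p \<and> x \<in> rim p q \<or> x = p \<and> v \<in> rim p q \<or> link p q v x))"

lemma adjacent_sym:
  assumes "adjacent P v x"
  shows "adjacent P x v"
proof -
  obtain p q where pq: "P = {p, q}" "p \<noteq> q" "v = p \<and> x \<in> rim p q \<or> x = p \<and> v \<in> rim p q \<or> link p q v x"
    using assms unfolding adjacent_def by blast
  have "P = {q, p}" using pq(1) by blast
  moreover have "link p q v x \<longleftrightarrow> link q p x v" unfolding link_def by blast
  ultimately show ?thesis using pq unfolding adjacent_def by metis
qed

lemma adjacent_unique: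
  assumes "adjacent P v x" "adjacent P' v x"
  shows "P = P'"
proof -
  obtain p q where 1: "P = {p, q}" "v = p \<and> x \<in> rim p q \<or> x = p \<and> v \<in> rim p q \<or> link p q v x"
    using assms(1) unfolding adjacent_def by blast
  obtain p' q' where 2: "P' = {p', q'}" "v = p' \<and> x \<in> rim p' q' \<or> x = p' \<and> v \<in> rim p' q' \<or> link p' q' v x"
    using assms(2) unfolding adjacent_def by blast
  have "p = p' \<and> q = q'"
    using 1(2) 2(2) rim_unique rim_nonsym rim_not_link link_unique by metis
  then show ?thesis using 1(1) 2(1) by simp
qed

lemma adjacent_eq:
  assumes "y \<noteq> u"
  shows "adjacent {y, u} v x \<longleftrightarrow> v \<in> {y, u} \<and> x \<in> rim y u \<or> x \<in> {y, u} \<and> v \<in> rim y u \<or>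
    link y u v x \<or> link u y v x"
proof -
  have "{y, u} = {p, q} \<and> p \<noteq> q \<longleftrightarrow> p = y \<and> q = u \<or> p = u \<and> q = y" for p q
    using assms by (auto simp: doubleton_eq_iff)
  then have "adjacent {y, u} v x \<longleftrightarrow>
    (\<exists>p q. (p = y \<and> q = u \<or> p = u \<and> q = y) \<and> (v = p \<and> x \<in> rim p q \<or> x = p \<and> v \<in> rim p q \<or> link p q v x))"
    by (simp only: adjacent_def conj_assoc[symmetric])
  also have "\<dots> \<longleftrightarrow> (v = y \<and> x \<in> rim y u \<or> x = y \<and> v \<in> rim y u \<or> link y u v x) \<or>
    (v = u \<and> x \<in> rim u y \<or> x = u \<and> v \<in> rim u y \<or> link u y v x)" by (simp only: conj_disj_distribR ex_disj_distrib conj_assoc simp_thms ex_simps)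
  finally show ?thesis unfolding rim_sym[of u y] by blast
qed

text \<open>Besides the poles these are the successor z and the predecessor w of v on the rim. They
  differ, since otherwise y and u would be middle points for the same outer pair.\<close>

lemma rim_adjacent:
  assumes "y \<noteq> u" "v \<in> rim y u"
  shows "\<exists>z w. {x. adjacent {y, u} v x} = {y, u, z, w} \<and> distinct [y, u, z, w] \<and>
    z \<in> rim y u - {v} \<and> w \<in> rim y u - {v}"
proof -
  obtain z w where zw: "(w, y, v) \<in> B" "(v, y, z) \<in> B" "(v, u, w) \<in> B" "(z, u, v) \<in> B"
    using assms(2) unfolding rim_def by blast
  have l: "link y u v x \<longleftrightarrow> x = z" "link u y v x \<longleftrightarrow> x = w" for x
    unfolding link_def using zw unique_first by blast+
  then have "z \<in> rim y u" "w \<in> rim u y" using link_rim by blast+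
  moreover have "v \<noteq> y" "v \<noteq> u" using rim_V assms(2) by blast+
  moreover from this have "v \<notin> {y, u}" by simp
  then have "{x. adjacent {y, u} v x} = {y, u, z, w}"
    unfolding adjacent_eq[OF assms(1)] l using assms(2) by blast
  moreover have "z \<noteq> w" using zw unique_outer[of v y z u] assms(1) by blast
  moreover have "z \<noteq> v" "w \<noteq> v" "z \<noteq> y" "z \<noteq> u" "w \<noteq> y" "w \<noteq> u"
    using zw[THEN distinct_block] by blast+
  ultimately have "{x. adjacent {y, u} v x} = {y, u, z, w} \<and> distinct [y, u, z, w] \<and>
    z \<in> rim y u - {v} \<and> w \<in> rim y u - {v}"
    using assms(1) rim_sym[of u y] by simp
  then show ?thesis by blast
qed

lemma card_V_notin:
  assumes "V \<noteq> {}"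
  shows "card V \<notin> {4, 6, 10, 12}"
proof (cases "even (card V)")
  case True
  define C where "C P = {x. \<exists>p q. P = {p, q} \<and> p \<noteq> q \<and> x \<in> rim p q}" for P
  define I where "I = {P. P \<subseteq> V \<and> card P = 2 \<and> odd (card (C P))}"
  have C: "C {y, u} = rim y u" if "y \<noteq> u" for y u
    using that rim_sym[of u y] by (auto simp: C_def doubleton_eq_iff)
  have I: "\<exists>y u. P = {y, u} \<and> y \<noteq> u \<and> y \<in> V \<and> u \<in> V" if "P \<in> I" for P
    using that by (auto simp: I_def card_2_iff)
  \<comment> \<open>A bipyramid is indexed by its pair of poles, so the map \<open>poles\<close> is
    the identity.\<close>
  interpret odd_cells V I "\<lambda>P. P" C "\<lambda>P v. {x. adjacent P v x}"
  proof
    show "finite I" using finite_V by (simp add: I_def)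
    show "card P = 2" "P \<subseteq> V" "odd (card (C P))" if "P \<in> I" for P
      using that by (simp_all add: I_def)
    show "C P \<subseteq> V" "P \<inter> C P = {}" if "P \<in> I" for P
      using I[OF that] C rim_V by fastforce+
    show "{x. adjacent P v x} = C P" if P: "P \<in> I" "v \<in> P" for P v
    proof -
      obtain y u where yu: "P = {y, u}" "y \<noteq> u" using I[OF P(1)] by blast
      have "v \<notin> rim y u" "v \<notin> rim u y" using rim_V P(2) yu(1) by blast+
      then have "\<not> link y u v x" "\<not> link u y v x" for x using link_rim by blast+
      then show ?thesis
        using \<open>v \<notin> rim y u\<close> P(2) unfolding yu(1) adjacent_eq[OF yu(2)] C[OF yu(2)] by blast
    qed
    show "P \<subseteq> {x. adjacent P v x} \<and> {x. adjacent P v x} \<subseteq> P \<union> (C P - {v}) \<and> card {x. adjacent P v x} = 4"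
      if P: "P \<in> I" "v \<in> C P" for P v
    proof -
      obtain y u where yu: "P = {y, u}" "y \<noteq> u" using I[OF P(1)] by blast
      obtain z w where "{x. adjacent P v x} = {y, u, z, w}" "distinct [y, u, z, w]"
        "z \<in> rim y u - {v}" "w \<in> rim y u - {v}"
        using rim_adjacent[OF yu(2), of v] P(2) C[OF yu(2)] yu(1) by auto
      then show ?thesis using C[OF yu(2)] yu(1) by auto
    qed
    show "{x. adjacent P v x} = {}" if P: "P \<in> I" "v \<notin> P" "v \<notin> C P" for P v
    proof -
      obtain y u where yu: "P = {y, u}" "y \<noteq> u" using I[OF P(1)] by blast
      have "v \<notin> rim y u" "v \<notin> rim u y" using P(3) C yu rim_sym[of u y] by auto
      then have "\<not> link y u v x" "\<not> link u y v x" for x using link_rim by blast+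
      then show ?thesis
        using \<open>v \<notin> rim y u\<close> P(2) unfolding yu(1) adjacent_eq[OF yu(2)] by blast
    qed
    show "odd (card {P \<in> I. v \<in> P})" if v: "v \<in> V" for v
    proof -
      let ?U = "{u \<in> V - {v}. odd (card (rim v u))}"
      have "{P \<in> I. v \<in> P} = (\<lambda>u. {v, u}) ` ?U"
      proof
        show "{P \<in> I. v \<in> P} \<subseteq> (\<lambda>u. {v, u}) ` ?U"
        proof
          fix P assume P: "P \<in> {P \<in> I. v \<in> P}"
          then obtain y u where yu: "P = {y, u}" "y \<noteq> u" "y \<in> V" "u \<in> V" using I by blast
          then obtain u' where u': "P = {v, u'}" "v \<noteq> u'" "u' \<in> V" using P by blast
          then have "u' \<in> ?U" using P C[of v u'] by (auto simp: I_def)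
          then show "P \<in> (\<lambda>u. {v, u}) ` ?U" using u'(1) by blast
        qed
        show "(\<lambda>u. {v, u}) ` ?U \<subseteq> {P \<in> I. v \<in> P}" using v C by (auto simp: I_def)
      qed
      moreover have "inj_on (\<lambda>u. {v, u}) ?U" by (auto simp: inj_on_def doubleton_eq_iff)
      ultimately have "card {P \<in> I. v \<in> P} = card ?U" by (simp add: card_image)
      then show ?thesis using odd_number_of_odd_rims[OF v True] by simp
    qed
    show "v \<in> {x. adjacent P w x}" if "w \<in> {x. adjacent P v x}" for P v w
      using that adjacent_sym by simp
    show "{x. adjacent P v x} \<inter> {x. adjacent Q v x} = {}" if "P \<noteq> Q" for P Q v
      using that adjacent_unique by blast
  qed (rule finite_V)
  show ?thesis using card_V_notin assms .
next
  case False
  \<comment> \<open>All four excluded orders are even.\<close>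
  then show ?thesis by auto
qed

text \<open>The blocks split the n(n - 1) ordered pairs into classes of three, and for n = 2 modulo
  3 this number is 2 modulo 3.\<close>

lemma card_V_mod_3: "card V mod 3 = 0 \<or> card V mod 3 = 1"
proof -
  have fin: "finite B"
    by (rule finite_subset[of _ "V \<times> V \<times> V"]) (use finite_V distinct_block in auto)
  have "pairs V = (\<Union>t\<in>B. ordered_pairs t)"
  proof
    show "pairs V \<subseteq> (\<Union>t\<in>B. ordered_pairs t)"
    proof
      fix e assume e: "e \<in> pairs V"
      obtain x y where xy: "e = (x, y)" by (cases e)
      have "\<exists>!t. t \<in> B \<and> (x, y) \<in> ordered_pairs t"
        by (rule ex1_block) (use e xy in \<open>auto simp: pairs_def\<close>)
      then show "e \<in> (\<Union>t\<in>B. ordered_pairs t)" unfolding xy by blast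
    qed
    show "(\<Union>t\<in>B. ordered_pairs t) \<subseteq> pairs V"
      using blocks ordered_pairs_subset_pairs by blast
  qed
  moreover have "card (\<Union>t\<in>B. ordered_pairs t) = (\<Sum>t\<in>B. card (ordered_pairs t))"
  proof (rule card_UN_disjoint[OF fin])
    show "\<forall>t\<in>B. finite (ordered_pairs t)" by auto
    show "\<forall>s\<in>B. \<forall>t\<in>B. s \<noteq> t \<longrightarrow> ordered_pairs s \<inter> ordered_pairs t = {}"
      using unique_block by fast
  qed
  moreover have "card (ordered_pairs t) = 3" if t: "t \<in> B" for t
  proof -
    obtain a b c where abc: "t = (a, b, c)" by (cases t)
    then show ?thesis using distinct_block[of a b c] t by auto
  qed
  ultimately have "card (pairs V) = 3 * card B" by simp
  moreover have "card (pairs V) = card V * card V - card V"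
  proof -
    have "pairs V = V \<times> V - (\<lambda>x. (x, x)) ` V" by (auto simp: pairs_def)
    moreover have "card ((\<lambda>x. (x, x)) ` V) = card V" by (rule card_image) (simp add: inj_on_def)
    moreover have "card (V \<times> V - (\<lambda>x. (x, x)) ` V) = card (V \<times> V) - card ((\<lambda>x. (x, x)) ` V)"
      using finite_V by (intro card_Diff_subset) auto
    ultimately show ?thesis by (simp add: card_cartesian_product)
  qed
  ultimately have "3 dvd card V * (card V - 1)" by (simp add: diff_mult_distrib2)
  have "card V mod 3 \<noteq> 2"
  proof
    assume "card V mod 3 = 2"
    then obtain k where k: "card V = 3 * k + 2" by (metis mult_div_mod_eq)
    have "card V * (card V - 1) = 3 * (3 * k * k + 3 * k) + 2"
      unfolding k by (simp add: algebra_simps)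
    then show False using \<open>3 dvd card V * (card V - 1)\<close> by presburger
  qed
  then show ?thesis by presburger
qed

end

theorem theorem4p7:
  fixes n :: nat
  assumes "n > 0"
  shows "(\<exists>(V :: nat set) (B :: nat ttriple set). flexible_ldts n V B) \<longleftrightarrow>
    (n mod 3 = 0 \<or> n mod 3 = 1) \<and> n \<notin> {4, 6, 10, 12}"
proof
  assume "\<exists>(V :: nat set) (B :: nat ttriple set). flexible_ldts n V B"
  then obtain V :: "nat set" and B where n: "card V = n" and VB: "flexible_system V B"
    using flexible_ldts_iff by blast
  interpret flexible_system V B by (rule VB)
  have "V \<noteq> {}" using n assms by auto
  then show "(n mod 3 = 0 \<or> n mod 3 = 1) \<and> n \<notin> {4, 6, 10, 12}"
    using card_V_mod_3 card_V_notin n by simp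
next
  assume n: "(n mod 3 = 0 \<or> n mod 3 = 1) \<and> n \<notin> {4, 6, 10, 12}"
  have "decomposable (pairs {..<n})" using n assms by (intro decomposable_pairs[of _ n]) auto
  then obtain B where "flexible_blocks (pairs {..<n}) B" unfolding decomposable_def by blast
  then have "flexible_system {..<n} B" using flexible_blocks_pairs_iff by blast
  then show "\<exists>(V :: nat set) (B :: nat ttriple set). flexible_ldts n V B"
    using flexible_ldts_iff[of n "{..<n}" B] by auto
qed

end
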